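(* Let $p\ge0$, $C_A\ge1$, let $D_\delta\to\infty$ as $\delta\to0$, and for every $\delta>0$ let $\lambda_1\ge\cdots\ge\lambda_{D_\delta}>0$ (possibly depending on $\delta$) satisfy $C_A^{-1}i^{-p}\le\lambda_i\le C_Ai^{-p}$ for $1\le i\le D_\delta$. (i) Let $\beta_+>\beta_-\ge0$ and $R_+,R_->0$. Suppose that there exists a $\mathcal G$-stopping rule $\tau$ such that $\mathcal R(\mu,\tau)\le C\,\mathcal R^*_{\beta,p,R}(\delta)$ holds for some $C>0$, all $\delta>0$ small enough, and every $\mu\in H^\beta(R,D_\delta)$, simultaneously for $(\beta,R)\in\{(\beta_-,R_-),(\beta_+,R_+)\}$. Then the rate-optimal truncation time for $H^{\beta_-}(R_-,D_\delta)$ must satisfy $\sqrt{D_\delta}=\mathcal O(t_{\beta_-,p,R_-}(\delta))$ as $\delta\to0$ (all other parameters being fixed). (ii) In particular, if a $\mathcal G$-stopping rule $\tau$ is rate-optimal over $H^\beta(R,D_\delta)$ for $\beta\in[\beta_{\min},\beta_{\max}]$, $\beta_{\max}>\beta_{\min}\ge0$, and some $R>0$, then necessarily $$\beta_{\max}\le\liminf_{\delta\to0}\frac{\log\delta^{-2}}{\log D_\delta}-p-\frac12.$$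
   Context: Model: $\delta>0$ is the noise level, $D=D_\delta\ge1$ an integer, $\lambda_1\ge\cdots\ge\lambda_D>0$ are known, and for a signal $\mu\in\mathbb{R}^D$ one observes $Y_i=\lambda_i\mu_i+\delta\varepsilon_i$, $i=1,\ldots,D$, with $\varepsilon_i$ independent $N(0,1)$; $\mathbb{E}_\mu$ is expectation under signal $\mu$. Truncated SVD estimators: $\widehat\mu^{(m)}_i=\mathbf 1(i\le m)\lambda_i^{-1}Y_i$, $0\le m\le D$. $\|\cdot\|$ is the Euclidean norm. Residual filtration: $\mathcal G_m=\sigma(Y_1,\ldots,Y_m)\vee\sigma(\|Y\|^2)$, $0\le m\le D$. A $\mathcal G$-stopping rule $\tau$ here is a family, indexed by $\delta$ (knowledge of $D_\delta$ and $\delta$ is allowed), of stopping times with respect to $(\mathcal G_m)_{0\le m\le D_\delta}$ with values in $\{0,\ldots,D_\delta\}$ (each a fixed function of the data, the same for all signals). $\mathcal R(\mu,\tau)=\mathbb{E}_\mu[\|\widehat\mu^{(\tau)}-\mu\|^2]^{1/2}$. Sobolev-type ellipsoids: $H^\beta(R,D)=\{\mu\in\mathbb{R}^D:\sum_{i=1}^Di^{2\beta}\mu_i^2\le R^2\}$. Notation: $t_{\beta,p,R}(\delta)=(R^{-1}\delta)^{-2/(2\beta+2p+1)}$ (the rate-optimal truncation time for $H^\beta(R,D_\delta)$) and $\mathcal R^*_{\beta,p,R}(\delta)=R(R^{-1}\delta)^{2\beta/(2\beta+2p+1)}$. "Rate-optimal over $H^\beta(R,D_\delta)$" means: there is $C>0$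 (possibly depending on $\beta$) with $\mathcal R(\mu,\tau)\le C\mathcal R^*_{\beta,p,R}(\delta)$ for all $\delta>0$ small enough and all $\mu\in H^\beta(R,D_\delta)$.
   Formalization: Part (i) is proved for β_- > 0 instead of β_- ≥ 0; at β_- = 0 it is false, since the rate over H^0(R_-) is the constant R_- and a deterministic rule tuned to β_+ attains both rates for arbitrarily fast growing D_δ. Part (ii) keeps β_min ≥ 0. *)

theory Defs
  imports "HOL-Probability.Probability"
begin

text \<open>
  A vector of dimension \<open>D\<close> is an extensional function on the index set \<open>{1..D}\<close>, since the
  dimension varies with the noise level. All random quantities are functions of the data
  \<open>Y = (Y\<^sub>1, \<dots>, Y\<^sub>D)\<close>; the sample space is the data space, equipped with the law of \<open>Y\<close> under
  the signal in question.
\<close>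

definition data_space :: "nat \<Rightarrow> (nat \<Rightarrow> real) measure" where
  "data_space D = Pi\<^sub>M {1..D} (\<lambda>_. borel)"

definition white_noise :: "nat \<Rightarrow> (nat \<Rightarrow> real) measure" where
  "white_noise D = Pi\<^sub>M {1..D} (\<lambda>_. density lborel (\<lambda>x. ennreal (std_normal_density x)))"

definition observation ::
  "nat \<Rightarrow> (nat \<Rightarrow> real) \<Rightarrow> real \<Rightarrow> (nat \<Rightarrow> real) \<Rightarrow> (nat \<Rightarrow> real) \<Rightarrow> (nat \<Rightarrow> real)" where
  "observation D lam \<delta> \<mu> \<epsilon> = (\<lambda>i\<in>{1..D}. lam i * \<mu> i + \<delta> * \<epsilon> i)"

definition data_law ::
  "nat \<Rightarrow> (nat \<Rightarrow> real) \<Rightarrow> real \<Rightarrow> (nat \<Rightarrow> real) \<Rightarrow> (nat \<Rightarrow> real) measure" where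
  "data_law D lam \<delta> \<mu> = distr (white_noise D) (data_space D) (observation D lam \<delta> \<mu>)"

definition tsvd_estimator :: "nat \<Rightarrow> (nat \<Rightarrow> real) \<Rightarrow> nat \<Rightarrow> (nat \<Rightarrow> real) \<Rightarrow> (nat \<Rightarrow> real)" where
  "tsvd_estimator D lam m y = (\<lambda>i\<in>{1..D}. of_bool (i \<le> m) * inverse (lam i) * y i)"

text \<open>
  The filtration is indexed by all natural numbers, as the library's notion of stopping time
  requires; it is constant from \<open>m = D\<close> on, so for rules with values in \<open>{0..D}\<close> the indices
  beyond \<open>D\<close> impose no condition.
\<close>

definition residual_filtration :: "nat \<Rightarrow> nat \<Rightarrow> (nat \<Rightarrow> real) measure" where
  "residual_filtration D m = sigma (space (data_space D))
     ({(\<lambda>y. y i) -` B \<inter> space (data_space D) | i B. i \<in> {1..min m D} \<and> B \<in> sets borel} \<union>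
      {(\<lambda>y. (L2_set y {1..D})\<^sup>2) -` B \<inter> space (data_space D) | B. B \<in> sets borel})"

lemma filtration_residual: "filtration (space (data_space D)) (residual_filtration D)"
proof
  show "space (residual_filtration D m) = space (data_space D)" for m
    unfolding residual_filtration_def by (rule space_measure_of) auto
  show "sets (residual_filtration D m) \<subseteq> sets (residual_filtration D n)" if "m \<le> n" for m n
  proof -
    have "min m D \<le> min n D" using that by auto
    then have "{1..min m D} \<subseteq> {1..min n D}" by auto
    then show ?thesis
      unfolding residual_filtration_def
      by (subst (1 2) sets_measure_of) (auto intro!: sigma_sets_mono')
  qed
qed

definition G_stopping_rule :: "(real \<Rightarrow> nat) \<Rightarrow> (real \<Rightarrow> (nat \<Rightarrow> real) \<Rightarrow> nat) \<Rightarrow> bool" where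
  "G_stopping_rule D \<tau> \<longleftrightarrow>
     (\<forall>\<delta>>0. stopping_time (residual_filtration (D \<delta>)) (\<tau> \<delta>) \<and>
            (\<forall>y\<in>space (data_space (D \<delta>)). \<tau> \<delta> y \<in> {0..D \<delta>}))"

definition risk ::
  "nat \<Rightarrow> (nat \<Rightarrow> real) \<Rightarrow> real \<Rightarrow> (nat \<Rightarrow> real) \<Rightarrow> ((nat \<Rightarrow> real) \<Rightarrow> nat) \<Rightarrow> real" where
  "risk D lam \<delta> \<mu> T =
     sqrt (\<integral>y. (L2_set (\<lambda>i. tsvd_estimator D lam (T y) y i - \<mu> i) {1..D})\<^sup>2 \<partial>data_law D lam \<delta> \<mu>)"

definition sobolev_ellipsoid :: "real \<Rightarrow> real \<Rightarrow> nat \<Rightarrow> (nat \<Rightarrow> real) set" where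
  "sobolev_ellipsoid \<beta> R D =
     {\<mu> \<in> {1..D} \<rightarrow>\<^sub>E UNIV. (\<Sum>i=1..D. real i powr (2 * \<beta>) * (\<mu> i)\<^sup>2) \<le> R\<^sup>2}"

definition opt_time :: "real \<Rightarrow> real \<Rightarrow> real \<Rightarrow> real \<Rightarrow> real" where
  "opt_time \<beta> p R \<delta> = (inverse R * \<delta>) powr (- 2 / (2 * \<beta> + 2 * p + 1))"

definition opt_rate :: "real \<Rightarrow> real \<Rightarrow> real \<Rightarrow> real \<Rightarrow> real" where
  "opt_rate \<beta> p R \<delta> = R * (inverse R * \<delta>) powr (2 * \<beta> / (2 * \<beta> + 2 * p + 1))"

definition rate_optimal ::
  "(real \<Rightarrow> nat) \<Rightarrow> (real \<Rightarrow> nat \<Rightarrow> real) \<Rightarrow> real \<Rightarrow> (real \<Rightarrow> (nat \<Rightarrow> real) \<Rightarrow> nat) \<Rightarrow> real \<Rightarrow> real \<Rightarrow> bool"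
where
  "rate_optimal D lam p \<tau> \<beta> R \<longleftrightarrow>
     (\<exists>C>0. \<forall>\<^sub>F \<delta> in at_right 0. \<forall>\<mu>\<in>sobolev_ellipsoid \<beta> R (D \<delta>).
        risk (D \<delta>) (lam \<delta>) \<delta> \<mu> (\<tau> \<delta>) \<le> C * opt_rate \<beta> p R \<delta>)"

end

theory Submission
  imports Defs "HOL-Real_Asymp.Real_Asymp"
begin

text \<open>
  The argument is a two-point lower bound. Suppose that a rule is rate-optimal over a rough class
  (exponent \<open>\<beta>\<close>, optimal time \<open>t\<close>) and over a smoother one. At the zero signal, which lies in
  both classes, the smooth rate is of smaller order than the standard deviation that truncation near
  \<open>t\<close> would incur; so the rule must stop before a small multiple \<open>k\<close> of \<open>t\<close> with high probability
  (\<open>prob_late_stopping_le\<close>). Now consider the spike of height \<open>R * k powr (- \<beta>)\<close> at \<open>k\<close>, an element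
  of the rough ellipsoid. For \<open>\<beta> > 0\<close> and \<open>k\<close> a small multiple of \<open>t\<close>, missing it costs a bias much
  larger than the rough rate.

  Before time \<open>k\<close> the spike is visible only in the squared norm \<open>\<parallel>Y\<parallel>\<^sup>2\<close>, where it adds an energy of order
  \<open>\<delta>\<^sup>2 t\<close>, while the noise in \<open>\<parallel>Y\<parallel>\<^sup>2\<close> fluctuates by order \<open>\<delta>\<^sup>2 sqrt D\<close>. If \<open>sqrt D\<close> were much larger than
  \<open>t\<close>, the rule could not tell the spike from the zero signal and would stop too early. Hence
  \<open>sqrt D = O(t)\<close>, which is the first claim; the second follows by taking logarithms and letting the
  rough exponent increase to \<open>\<beta>_max\<close>.

  The quantitative form of "cannot tell" is \<open>data_law_residual_indistinguishable\<close>. By rotation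
  invariance the tail energy has the same law when the spike is spread evenly over the \<open>n\<close> tail
  coordinates, and, since only squares matter, when each of these equal shifts gets an independent
  random sign. The random signs turn the alternative into a product of two-point mixtures of normal
  laws, whose chi-square divergence from pure noise is \<open>cosh (b\<^sup>2) ^ n - 1\<close>; this is at most
  \<open>exp (a\<^sup>2 / (2 n)) - 1\<close>, where \<open>a = n b\<^sup>2\<close> is the energy of the spike in units of \<open>\<delta>\<^sup>2\<close>.
\<close>

section \<open>Rotation invariance of the Gaussian measure\<close>

abbreviation std_gauss :: "real measure" where
  "std_gauss \<equiv> density lborel (\<lambda>x. ennreal (std_normal_density x))"

lemma prob_space_std_gauss: "prob_space std_gauss"
  by (rule prob_space_normal_density) simp

interpretation std_gauss: prob_space std_gauss
  by (rule prob_space_std_gauss)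

interpretation std_gauss_PiM: product_sigma_finite "\<lambda>_::nat. std_gauss"
  by (simp add: product_sigma_finite_def std_gauss.sigma_finite_measure_axioms)

lemma nn_integral_shear_fst:
  fixes f :: "real \<times> real \<Rightarrow> ennreal"
  assumes [measurable]: "f \<in> borel_measurable borel"
  shows "(\<integral>\<^sup>+x. \<integral>\<^sup>+y. f (x + s * y, y) \<partial>lborel \<partial>lborel) = (\<integral>\<^sup>+x. \<integral>\<^sup>+y. f (x, y) \<partial>lborel \<partial>lborel)"
proof -
  have "(\<integral>\<^sup>+x. \<integral>\<^sup>+y. f (x + s * y, y) \<partial>lborel \<partial>lborel) = (\<integral>\<^sup>+y. \<integral>\<^sup>+x. f (x + s * y, y) \<partial>lborel \<partial>lborel)"
    by (rule lborel_pair.Fubini') (simp add: borel_prod split_beta)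
  also have "\<dots> = (\<integral>\<^sup>+y. \<integral>\<^sup>+x. f (x, y) \<partial>lborel \<partial>lborel)"
    using nn_integral_real_affine[of "\<lambda>x. f (x, y)" 1 "s * y" for y]
    by (simp add: add.commute)
  also have "\<dots> = (\<integral>\<^sup>+x. \<integral>\<^sup>+y. f (x, y) \<partial>lborel \<partial>lborel)"
    by (rule lborel_pair.Fubini') (simp add: lborel_prod split_beta)
  finally show ?thesis .
qed

lemma nn_integral_shear_snd:
  fixes f :: "real \<times> real \<Rightarrow> ennreal"
  assumes [measurable]: "f \<in> borel_measurable borel"
  shows "(\<integral>\<^sup>+x. \<integral>\<^sup>+y. f (x, y + s * x) \<partial>lborel \<partial>lborel) = (\<integral>\<^sup>+x. \<integral>\<^sup>+y. f (x, y) \<partial>lborel \<partial>lborel)"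
proof (rule nn_integral_cong)
  fix x :: real
  show "(\<integral>\<^sup>+y. f (x, y + s * x) \<partial>lborel) = (\<integral>\<^sup>+y. f (x, y) \<partial>lborel)"
    using nn_integral_real_affine[of "\<lambda>y. f (x, y)" 1 "s * x"] by (simp add: add.commute)
qed

text \<open>
  A rotation by an angle \<open>\<theta>\<close> is the composition of three shears, with slopes
  \<open>- tan (\<theta> / 2)\<close>, \<open>sin \<theta>\<close> and \<open>- tan (\<theta> / 2)\<close>. A shear translates each line parallel to an
  axis, so by Fubini it preserves Lebesgue measure. With \<open>u \<ge> 0\<close> the half-angle tangent
  \<open>v / (1 + u)\<close> is finite.
\<close>

lemma nn_integral_rotation:
  fixes f :: "real \<times> real \<Rightarrow> ennreal"
  assumes [measurable]: "f \<in> borel_measurable borel" and u: "u\<^sup>2 + v\<^sup>2 = 1" "u \<ge> 0"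
  shows "(\<integral>\<^sup>+x. \<integral>\<^sup>+y. f (u * x - v * y, v * x + u * y) \<partial>lborel \<partial>lborel)
       = (\<integral>\<^sup>+x. \<integral>\<^sup>+y. f (x, y) \<partial>lborel \<partial>lborel)"
proof -
  define a where "a = - v / (1 + u)"
  have a: "1 + a * v = u" "a * (1 + u) = - v"
    using u by (auto simp: a_def field_simps power2_eq_square)
  define g where "g = (\<lambda>(x, y). f (x + a * y, y))"
  define k where "k = (\<lambda>(x, y). g (x, y + v * x))"
  have [measurable]: "g \<in> borel_measurable borel"
    unfolding g_def borel_prod[symmetric] split_beta by simp
  have [measurable]: "k \<in> borel_measurable borel"
    unfolding k_def borel_prod[symmetric] split_beta by simp
  have "f (u * x - v * y, v * x + u * y) = k (x + a * y, y)" for x y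
  proof -
    have "y + v * (x + a * y) = v * x + u * y"
      by (simp add: a(1)[symmetric] algebra_simps)
    moreover have "x + a * y + a * (v * x + u * y) = u * x - v * y"
    proof -
      have "x + a * y + a * (v * x + u * y) = (1 + a * v) * x + (a * (1 + u)) * y"
        by (simp add: algebra_simps)
      then show ?thesis by (simp add: a)
    qed
    ultimately show ?thesis by (simp add: k_def g_def)
  qed
  then have "(\<integral>\<^sup>+x. \<integral>\<^sup>+y. f (u * x - v * y, v * x + u * y) \<partial>lborel \<partial>lborel)
      = (\<integral>\<^sup>+x. \<integral>\<^sup>+y. k (x + a * y, y) \<partial>lborel \<partial>lborel)" by simp
  also have "\<dots> = (\<integral>\<^sup>+x. \<integral>\<^sup>+y. k (x, y) \<partial>lborel \<partial>lborel)"
    by (rule nn_integral_shear_fst) simp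
  also have "\<dots> = (\<integral>\<^sup>+x. \<integral>\<^sup>+y. g (x, y) \<partial>lborel \<partial>lborel)"
    using nn_integral_shear_snd[of g v] by (simp add: k_def)
  also have "\<dots> = (\<integral>\<^sup>+x. \<integral>\<^sup>+y. f (x, y) \<partial>lborel \<partial>lborel)"
    using nn_integral_shear_fst[of f a] by (simp add: g_def)
  finally show ?thesis .
qed

lemma nn_integral_std_gauss_shift:
  fixes g :: "real \<Rightarrow> ennreal"
  assumes [measurable]: "g \<in> borel_measurable borel"
  shows "(\<integral>\<^sup>+x. g (x + c) \<partial>std_gauss) = (\<integral>\<^sup>+x. ennreal (std_normal_density (x - c)) * g x \<partial>lborel)"
proof -
  have "(\<integral>\<^sup>+x. g (x + c) \<partial>std_gauss) = (\<integral>\<^sup>+x. ennreal (std_normal_density x) * g (x + c) \<partial>lborel)"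
    by (subst nn_integral_density) auto
  also have "\<dots> = (\<integral>\<^sup>+x. ennreal (std_normal_density (x - c)) * g x \<partial>lborel)"
    using nn_integral_real_affine[of "\<lambda>x. ennreal (std_normal_density (x - c)) * g x" 1 c]
    by (simp add: add.commute)
  finally show ?thesis .
qed

lemma nn_integral_std_gauss_reflect:
  fixes g :: "real \<Rightarrow> ennreal"
  assumes [measurable]: "g \<in> borel_measurable borel"
  shows "(\<integral>\<^sup>+x. g (- x) \<partial>std_gauss) = (\<integral>\<^sup>+x. g x \<partial>std_gauss)"
proof -
  have "(\<integral>\<^sup>+x. g (- x) \<partial>std_gauss) = (\<integral>\<^sup>+x. ennreal (std_normal_density x) * g (- x) \<partial>lborel)"
    by (subst nn_integral_density) auto
  also have "\<dots> = (\<integral>\<^sup>+x. ennreal (std_normal_density x) * g x \<partial>lborel)"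
    using nn_integral_real_affine[of "\<lambda>x. ennreal (std_normal_density x) * g x" "-1" 0]
    by (simp add: std_normal_density_def)
  also have "\<dots> = (\<integral>\<^sup>+x. g x \<partial>std_gauss)"
    by (subst nn_integral_density) auto
  finally show ?thesis .
qed

lemma nn_integral_std_gauss_shift_abs:
  fixes h :: "real \<Rightarrow> ennreal"
  assumes [measurable]: "h \<in> borel_measurable borel"
  shows "(\<integral>\<^sup>+x. h ((x + c)\<^sup>2) \<partial>std_gauss) = (\<integral>\<^sup>+x. h ((x + \<bar>c\<bar>)\<^sup>2) \<partial>std_gauss)"
proof (cases "c \<ge> 0")
  case False
  have "(- x + \<bar>c\<bar>)\<^sup>2 = (x + c)\<^sup>2" for x using False by (simp add: power2_eq_square algebra_simps)
  then show ?thesis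
    using nn_integral_std_gauss_reflect[of "\<lambda>x. h ((x + \<bar>c\<bar>)\<^sup>2)"] by simp
qed simp

lemma std_normal_density_mult:
  "ennreal (std_normal_density x) * (ennreal (std_normal_density y) * e)
     = ennreal (exp (- (x\<^sup>2 + y\<^sup>2) / 2) / (2 * pi)) * e"
  by (simp add: std_normal_density_def mult.assoc[symmetric] ennreal_mult'[symmetric]
       exp_add[symmetric] add_divide_distrib)
     (simp add: exp_diff exp_minus field_simps)

text \<open>
  In the plane, the squared length of a Gaussian vector shifted by \<open>(c, d)\<close> depends only on the
  length of the shift: rotate the shift onto the second axis. The density of the shifted vector is
  the exponential of minus half the squared distance to \<open>(c, d)\<close>, which rotates along. The sign of
  \<open>d\<close> is removed beforehand by reflection, so that the rotation is by at most a right angle.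
\<close>

lemma nn_integral_std_gauss_two:
  fixes h :: "real \<Rightarrow> ennreal"
  assumes [measurable]: "h \<in> borel_measurable borel"
  shows "(\<integral>\<^sup>+x. \<integral>\<^sup>+y. h ((x + c)\<^sup>2 + (y + d)\<^sup>2) \<partial>std_gauss \<partial>std_gauss)
       = (\<integral>\<^sup>+x. \<integral>\<^sup>+y. h (x\<^sup>2 + (y + sqrt (c\<^sup>2 + d\<^sup>2))\<^sup>2) \<partial>std_gauss \<partial>std_gauss)"
proof (cases "c = 0 \<and> d = 0")
  case False
  define r where "r = sqrt (c\<^sup>2 + d\<^sup>2)"
  define u where "u = \<bar>d\<bar> / r"
  define v where "v = c / r"
  have r: "r > 0" "r\<^sup>2 = c\<^sup>2 + d\<^sup>2"
    using False by (auto simp: r_def sum_power2_gt_zero_iff)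
  have uv: "u\<^sup>2 + v\<^sup>2 = 1" "u \<ge> 0" "r * u = \<bar>d\<bar>" "r * v = c"
    using r by (auto simp: u_def v_def power_divide add_divide_distrib[symmetric])
  have lebesgue: "(\<integral>\<^sup>+x. \<integral>\<^sup>+y. h ((x + a)\<^sup>2 + (y + b)\<^sup>2) \<partial>std_gauss \<partial>std_gauss)
     = (\<integral>\<^sup>+x. \<integral>\<^sup>+y. ennreal (exp (- ((x - a)\<^sup>2 + (y - b)\<^sup>2) / 2) / (2 * pi)) * h (x\<^sup>2 + y\<^sup>2) \<partial>lborel \<partial>lborel)" for a b
  proof -
    have "(\<integral>\<^sup>+x. \<integral>\<^sup>+y. h ((x + a)\<^sup>2 + (y + b)\<^sup>2) \<partial>std_gauss \<partial>std_gauss)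
       = (\<integral>\<^sup>+x. ennreal (std_normal_density (x - a)) * (\<integral>\<^sup>+y. h (x\<^sup>2 + (y + b)\<^sup>2) \<partial>std_gauss) \<partial>lborel)"
      by (rule nn_integral_std_gauss_shift) simp
    also have "\<dots> = (\<integral>\<^sup>+x. ennreal (std_normal_density (x - a)) *
        (\<integral>\<^sup>+y. ennreal (std_normal_density (y - b)) * h (x\<^sup>2 + y\<^sup>2) \<partial>lborel) \<partial>lborel)"
      by (intro nn_integral_cong arg_cong2[where f = "(*)"] refl nn_integral_std_gauss_shift) simp
    also have "\<dots> = (\<integral>\<^sup>+x. \<integral>\<^sup>+y. ennreal (std_normal_density (x - a)) *
        (ennreal (std_normal_density (y - b)) * h (x\<^sup>2 + y\<^sup>2)) \<partial>lborel \<partial>lborel)"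
      by (intro nn_integral_cong nn_integral_cmult[symmetric]) simp
    finally show ?thesis by (simp only: std_normal_density_mult)
  qed
  define F where "F = (\<lambda>(x, y). ennreal (exp (- (x\<^sup>2 + (y - r)\<^sup>2) / 2) / (2 * pi)) * h (x\<^sup>2 + y\<^sup>2))"
  have [measurable]: "F \<in> borel_measurable borel"
    unfolding F_def borel_prod[symmetric] by simp
  have rot: "F (u * x - v * y, v * x + u * y)
      = ennreal (exp (- ((x - c)\<^sup>2 + (y - \<bar>d\<bar>)\<^sup>2) / 2) / (2 * pi)) * h (x\<^sup>2 + y\<^sup>2)" for x y
  proof -
    have q: "(u * x - v * y)\<^sup>2 + (v * x + u * y)\<^sup>2 = x\<^sup>2 + y\<^sup>2"
      using uv(1) by algebra
    have "(u * x - v * y)\<^sup>2 + (v * x + u * y - r)\<^sup>2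
        = (x\<^sup>2 + y\<^sup>2) - 2 * (x * (r * v) + y * (r * u)) + r\<^sup>2"
      unfolding q[symmetric] by (simp add: power2_eq_square algebra_simps)
    also have "\<dots> = (x - c)\<^sup>2 + (y - \<bar>d\<bar>)\<^sup>2"
      unfolding uv r by (simp add: power2_eq_square algebra_simps)
    finally show ?thesis using q by (simp only: F_def prod.case)
  qed
  have "(\<integral>\<^sup>+x. \<integral>\<^sup>+y. h ((x + c)\<^sup>2 + (y + d)\<^sup>2) \<partial>std_gauss \<partial>std_gauss)
      = (\<integral>\<^sup>+x. \<integral>\<^sup>+y. h ((x + c)\<^sup>2 + (y + \<bar>d\<bar>)\<^sup>2) \<partial>std_gauss \<partial>std_gauss)"
    by (intro nn_integral_cong nn_integral_std_gauss_shift_abs[of "\<lambda>q. h (_ + q)"]) simp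
  also have "\<dots> = (\<integral>\<^sup>+x. \<integral>\<^sup>+y. F (u * x - v * y, v * x + u * y) \<partial>lborel \<partial>lborel)"
    by (simp only: lebesgue rot)
  also have "\<dots> = (\<integral>\<^sup>+x. \<integral>\<^sup>+y. F (x, y) \<partial>lborel \<partial>lborel)"
    using uv by (intro nn_integral_rotation) auto
  also have "\<dots> = (\<integral>\<^sup>+x. \<integral>\<^sup>+y. h (x\<^sup>2 + (y + r)\<^sup>2) \<partial>std_gauss \<partial>std_gauss)"
    using lebesgue[of 0 r] by (simp add: F_def)
  finally show ?thesis by (simp add: r_def)
qed simp

text \<open>
  Rotating two coordinates at a time moves the whole shift onto the coordinate \<open>j\<close>. As the right-hand
  side contains the shift only through \<open>\<Sum> (c i)\<^sup>2\<close>, the law of \<open>\<Sum> (x i + c i)\<^sup>2\<close> depends only on the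
  Euclidean norm of \<open>c\<close>.
\<close>

lemma nn_integral_PiM_std_gauss_norm_shift:
  fixes h :: "real \<Rightarrow> ennreal" and c :: "nat \<Rightarrow> real"
  assumes "finite K" "j \<notin> K" "h \<in> borel_measurable borel"
  shows "(\<integral>\<^sup>+x. h (\<Sum>i\<in>insert j K. (x i + c i)\<^sup>2) \<partial>PiM (insert j K) (\<lambda>_. std_gauss))
       = (\<integral>\<^sup>+x. \<integral>\<^sup>+y. h ((\<Sum>i\<in>K. (x i)\<^sup>2) + (y + sqrt (\<Sum>i\<in>insert j K. (c i)\<^sup>2))\<^sup>2) \<partial>std_gauss \<partial>PiM K (\<lambda>_. std_gauss))"
  using assms
proof (induction K arbitrary: h rule: finite_induct)
  case empty
  note [measurable] = empty.prems(2)
  have "(\<integral>\<^sup>+x. h ((x j + c j)\<^sup>2) \<partial>PiM {j} (\<lambda>_. std_gauss)) = (\<integral>\<^sup>+y. h ((y + c j)\<^sup>2) \<partial>std_gauss)"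
    by (rule std_gauss_PiM.product_nn_integral_singleton[of "\<lambda>y. h ((y + c j)\<^sup>2)"]) simp
  also have "\<dots> = (\<integral>\<^sup>+y. h ((y + \<bar>c j\<bar>)\<^sup>2) \<partial>std_gauss)"
    by (rule nn_integral_std_gauss_shift_abs) simp
  finally show ?case
    by (simp add: nn_integral_count_space_finite PiM_empty space_PiM)
next
  case (insert k K)
  note [measurable] = insert.prems(2)
  have fin: "finite (insert j K)" and k: "k \<notin> insert j K" and j: "j \<notin> K"
    using insert by auto
  let ?R = "sqrt (\<Sum>i\<in>insert j K. (c i)\<^sup>2)"
  interpret PiM: finite_product_sigma_finite "\<lambda>_::nat. std_gauss" K
    by standard (rule insert.hyps)
  have pair_PiM: "pair_sigma_finite (PiM K (\<lambda>_. std_gauss)) std_gauss"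
    by (simp add: pair_sigma_finite_def PiM.sigma_finite_measure_axioms std_gauss.sigma_finite_measure_axioms)
  have "(\<integral>\<^sup>+x. h (\<Sum>i\<in>insert j (insert k K). (x i + c i)\<^sup>2) \<partial>PiM (insert j (insert k K)) (\<lambda>_. std_gauss))
      = (\<integral>\<^sup>+x. h ((x k + c k)\<^sup>2 + (\<Sum>i\<in>insert j K. (x i + c i)\<^sup>2)) \<partial>PiM (insert k (insert j K)) (\<lambda>_. std_gauss))"
    using fin k by (simp add: insert_commute[of j k] del: sum.insert) (simp add: sum.insert)
  also have "\<dots> = (\<integral>\<^sup>+z. \<integral>\<^sup>+x. h ((z + c k)\<^sup>2 + (\<Sum>i\<in>insert j K. (x i + c i)\<^sup>2)) \<partial>PiM (insert j K) (\<lambda>_. std_gauss) \<partial>std_gauss)"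
  proof -
    have "(\<Sum>i\<in>insert j K. ((x(k := z)) i + c i)\<^sup>2) = (\<Sum>i\<in>insert j K. (x i + c i)\<^sup>2)" for x z
      using k by (intro sum.cong) auto
    then show ?thesis using fin k
      by (subst std_gauss_PiM.product_nn_integral_insert_rev) (auto simp del: sum.insert)
  qed
  also have "\<dots> = (\<integral>\<^sup>+z. \<integral>\<^sup>+x. \<integral>\<^sup>+y. h ((z + c k)\<^sup>2 + ((\<Sum>i\<in>K. (x i)\<^sup>2) + (y + ?R)\<^sup>2)) \<partial>std_gauss \<partial>PiM K (\<lambda>_. std_gauss) \<partial>std_gauss)"
    by (intro nn_integral_cong insert.IH[OF j]) simp
  also have "\<dots> = (\<integral>\<^sup>+x. \<integral>\<^sup>+z. \<integral>\<^sup>+y. h ((z + c k)\<^sup>2 + ((\<Sum>i\<in>K. (x i)\<^sup>2) + (y + ?R)\<^sup>2)) \<partial>std_gauss \<partial>std_gauss \<partial>PiM K (\<lambda>_. std_gauss))"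
    using pair_PiM by (rule pair_sigma_finite.Fubini') simp
  also have "\<dots> = (\<integral>\<^sup>+x. \<integral>\<^sup>+z. \<integral>\<^sup>+y. h ((\<Sum>i\<in>K. (x i)\<^sup>2) + (z\<^sup>2 + (y + sqrt ((c k)\<^sup>2 + ?R\<^sup>2))\<^sup>2)) \<partial>std_gauss \<partial>std_gauss \<partial>PiM K (\<lambda>_. std_gauss))"
    using nn_integral_std_gauss_two[of "\<lambda>q. h ((\<Sum>i\<in>K. (x i)\<^sup>2) + q)" "c k" ?R for x]
    by (simp add: add_ac)
  also have "\<dots> = (\<integral>\<^sup>+x. \<integral>\<^sup>+y. h ((\<Sum>i\<in>insert k K. (x i)\<^sup>2) + (y + sqrt ((c k)\<^sup>2 + ?R\<^sup>2))\<^sup>2) \<partial>std_gauss \<partial>PiM (insert k K) (\<lambda>_. std_gauss))"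
  proof -
    have "(\<Sum>i\<in>K. ((x(k := z)) i)\<^sup>2) = (\<Sum>i\<in>K. (x i)\<^sup>2)" for x and z :: real
      using insert.hyps by (intro sum.cong) auto
    then show ?thesis using insert.hyps
      by (subst std_gauss_PiM.product_nn_integral_insert) (auto simp: add_ac)
  qed
  finally show ?case
    using insert.hyps fin k by (simp add: insert_commute[of j k] sum_nonneg)
qed

section \<open>Undetectability of a small shift from the energy\<close>

text \<open>
  The density, relative to \<open>N(0, 1)\<close>, of the balanced mixture of \<open>N(b, 1)\<close> and \<open>N(- b, 1)\<close>.
\<close>

definition sym_shift_ratio :: "real \<Rightarrow> real \<Rightarrow> real" where
  "sym_shift_ratio b x = exp (- b\<^sup>2 / 2) * cosh (b * x)"

lemma borel_measurable_sym_shift_ratio [measurable]: "sym_shift_ratio b \<in> borel_measurable borel"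
  unfolding sym_shift_ratio_def cosh_def by simp

lemma sym_shift_ratio_nonneg [simp]: "sym_shift_ratio b x \<ge> 0"
  by (simp add: sym_shift_ratio_def)

lemma std_normal_density_sym_shift:
  "std_normal_density (x - b) + std_normal_density (x + b)
     = 2 * (std_normal_density x * sym_shift_ratio b x)"
  by (simp add: std_normal_density_def sym_shift_ratio_def cosh_def exp_add[symmetric] field_simps
      power2_eq_square exp_diff exp_minus mult_exp_exp)

text \<open>
  A function of the square does not see the sign of the shift, so \<open>N(b, 1)\<close> may be replaced by the
  balanced mixture of \<open>N(b, 1)\<close> and \<open>N(- b, 1)\<close>. This is what makes the comparison below sharp: the
  likelihood ratio of the mixture deviates from 1 only by order \<open>b\<^sup>2\<close>, that of \<open>N(b, 1)\<close> by order \<open>b\<close>.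
\<close>

lemma nn_integral_std_gauss_sym_shift:
  fixes h :: "real \<Rightarrow> ennreal"
  assumes [measurable]: "h \<in> borel_measurable borel"
  shows "(\<integral>\<^sup>+x. h ((x + b)\<^sup>2) \<partial>std_gauss) = (\<integral>\<^sup>+x. h (x\<^sup>2) * ennreal (sym_shift_ratio b x) \<partial>std_gauss)"
    (is "?A = ?B")
proof -
  have A: "?A = (\<integral>\<^sup>+x. ennreal (std_normal_density (x - b)) * h (x\<^sup>2) \<partial>lborel)"
    by (rule nn_integral_std_gauss_shift) simp
  have "?A = (\<integral>\<^sup>+x. h ((- x + b)\<^sup>2) \<partial>std_gauss)"
    by (rule nn_integral_std_gauss_reflect[symmetric]) simp
  also have "\<dots> = (\<integral>\<^sup>+x. h ((x + (- b))\<^sup>2) \<partial>std_gauss)"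
    by (simp add: power2_commute)
  also have "\<dots> = (\<integral>\<^sup>+x. ennreal (std_normal_density (x + b)) * h (x\<^sup>2) \<partial>lborel)"
    by (subst nn_integral_std_gauss_shift) simp_all
  finally have A': "?A = (\<integral>\<^sup>+x. ennreal (std_normal_density (x + b)) * h (x\<^sup>2) \<partial>lborel)" .
  have "2 * ?A = ?A + ?A" by (simp add: mult_2)
  also have "\<dots> = (\<integral>\<^sup>+x. ennreal (std_normal_density (x - b)) * h (x\<^sup>2) \<partial>lborel)
      + (\<integral>\<^sup>+x. ennreal (std_normal_density (x + b)) * h (x\<^sup>2) \<partial>lborel)"
    by (subst (1) A, subst A') simp
  also have "\<dots> = (\<integral>\<^sup>+x. ennreal (std_normal_density (x - b) + std_normal_density (x + b)) * h (x\<^sup>2) \<partial>lborel)"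
    by (subst nn_integral_add[symmetric]) (auto simp: ennreal_plus distrib_right)
  also have "\<dots> = (\<integral>\<^sup>+x. 2 * (ennreal (std_normal_density x) * (h (x\<^sup>2) * ennreal (sym_shift_ratio b x))) \<partial>lborel)"
    unfolding std_normal_density_sym_shift by (simp add: ennreal_mult' mult_ac)
  also have "\<dots> = 2 * ?B"
    by (subst nn_integral_cmult, measurable, subst nn_integral_density) auto
  finally show ?thesis by (simp add: ennreal_mult_cancel_left)
qed

lemma nn_integral_PiM_std_gauss_sym_shift:
  fixes h :: "real \<Rightarrow> ennreal" and K :: "nat set"
  assumes "finite K" "h \<in> borel_measurable borel"
  shows "(\<integral>\<^sup>+x. h (\<Sum>i\<in>K. (x i + b)\<^sup>2) \<partial>PiM K (\<lambda>_. std_gauss))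
       = (\<integral>\<^sup>+x. h (\<Sum>i\<in>K. (x i)\<^sup>2) * ennreal (\<Prod>i\<in>K. sym_shift_ratio b (x i)) \<partial>PiM K (\<lambda>_. std_gauss))"
  using assms
proof (induction K arbitrary: h rule: finite_induct)
  case (insert k K)
  note [measurable] = insert.prems
  have upd: "(\<Sum>i\<in>K. f ((x(k := z)) i)) = (\<Sum>i\<in>K. f (x i))"
    "(\<Prod>i\<in>K. f ((x(k := z)) i)) = (\<Prod>i\<in>K. f (x i))" for f :: "real \<Rightarrow> real" and x z
    using insert.hyps by (auto intro!: sum.cong prod.cong)
  interpret PiM: finite_product_sigma_finite "\<lambda>_::nat. std_gauss" K
    by standard (rule insert.hyps)
  have pair_PiM: "pair_sigma_finite (PiM K (\<lambda>_. std_gauss)) std_gauss"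
    by (simp add: pair_sigma_finite_def PiM.sigma_finite_measure_axioms std_gauss.sigma_finite_measure_axioms)
  have "(\<integral>\<^sup>+x. h (\<Sum>i\<in>insert k K. (x i + b)\<^sup>2) \<partial>PiM (insert k K) (\<lambda>_. std_gauss))
      = (\<integral>\<^sup>+z. \<integral>\<^sup>+x. h ((z + b)\<^sup>2 + (\<Sum>i\<in>K. (x i + b)\<^sup>2)) \<partial>PiM K (\<lambda>_. std_gauss) \<partial>std_gauss)"
    using insert.hyps upd(1)[of "\<lambda>y. (y + b)\<^sup>2"]
    by (subst std_gauss_PiM.product_nn_integral_insert_rev) auto
  also have "\<dots> = (\<integral>\<^sup>+z. \<integral>\<^sup>+x. h ((z + b)\<^sup>2 + (\<Sum>i\<in>K. (x i)\<^sup>2)) * ennreal (\<Prod>i\<in>K. sym_shift_ratio b (x i)) \<partial>PiM K (\<lambda>_. std_gauss) \<partial>std_gauss)"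
    by (intro nn_integral_cong insert.IH) simp
  also have "\<dots> = (\<integral>\<^sup>+x. \<integral>\<^sup>+z. h ((z + b)\<^sup>2 + (\<Sum>i\<in>K. (x i)\<^sup>2)) * ennreal (\<Prod>i\<in>K. sym_shift_ratio b (x i)) \<partial>std_gauss \<partial>PiM K (\<lambda>_. std_gauss))"
    using pair_PiM by (rule pair_sigma_finite.Fubini') simp
  also have "\<dots> = (\<integral>\<^sup>+x. \<integral>\<^sup>+z. h (z\<^sup>2 + (\<Sum>i\<in>K. (x i)\<^sup>2)) * ennreal (sym_shift_ratio b z * (\<Prod>i\<in>K. sym_shift_ratio b (x i))) \<partial>std_gauss \<partial>PiM K (\<lambda>_. std_gauss))"
    by (subst nn_integral_std_gauss_sym_shift[of "\<lambda>q. h (q + _) * _"])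
       (auto simp: ennreal_mult' mult_ac)
  also have "\<dots> = (\<integral>\<^sup>+x. h (\<Sum>i\<in>insert k K. (x i)\<^sup>2) * ennreal (\<Prod>i\<in>insert k K. sym_shift_ratio b (x i)) \<partial>PiM (insert k K) (\<lambda>_. std_gauss))"
    using insert.hyps upd(1)[of "\<lambda>y. y\<^sup>2"] upd(2)[of "sym_shift_ratio b"]
    by (subst std_gauss_PiM.product_nn_integral_insert) auto
  finally show ?case .
qed (simp add: PiM_empty)

text \<open>
  Completing the square turns each exponential in the expansion of \<open>cosh\<^sup>2\<close> into a normal density.
\<close>

lemma std_normal_density_sq_ratio:
  "std_normal_density x * (sym_shift_ratio b x)\<^sup>2
     = exp (b\<^sup>2) / 4 * (normal_density (2 * b) 1 x + normal_density (- 2 * b) 1 x)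
       + exp (- b\<^sup>2) / 2 * std_normal_density x"
proof -
  have "exp (b\<^sup>2) * exp (- (x - 2 * b)\<^sup>2 / 2) = exp (- x\<^sup>2 / 2) * exp (- b\<^sup>2) * exp (b * x)^2"
    "exp (b\<^sup>2) * exp (- (x + 2 * b)\<^sup>2 / 2) = exp (- x\<^sup>2 / 2) * exp (- b\<^sup>2) * exp (- (b * x))^2"
    by (simp_all add: exp_add[symmetric] exp_of_nat_mult[symmetric] power2_eq_square algebra_simps)
       (simp_all add: mult_exp_exp field_simps)
  note e = this
  have s: "(exp (- b\<^sup>2 / 2))\<^sup>2 = exp (- b\<^sup>2)"
    by (simp add: power2_eq_square mult_exp_exp)
  have "exp (b * x) * exp (- (b * x)) = 1"
    by (simp add: mult_exp_exp)
  then have "(cosh (b * x))\<^sup>2 = (exp (b * x)^2 + exp (- (b * x))^2 + 2) / 4"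
    by (simp add: cosh_field_def power2_sum power_divide)
  then show ?thesis
    unfolding sym_shift_ratio_def power_mult_distrib s normal_density_def std_normal_density_def
    using e by (simp add: algebra_simps add_divide_distrib) 
qed

lemma nn_integral_sym_shift_ratio_sq:
  "(\<integral>\<^sup>+x. ennreal ((sym_shift_ratio b x)\<^sup>2) \<partial>std_gauss) = ennreal (cosh (b\<^sup>2))"
proof -
  have "(\<integral>\<^sup>+x. ennreal ((sym_shift_ratio b x)\<^sup>2) \<partial>std_gauss)
      = (\<integral>\<^sup>+x. ennreal (std_normal_density x * (sym_shift_ratio b x)\<^sup>2) \<partial>lborel)"
    by (subst nn_integral_density) (auto simp: ennreal_mult')
  also have "\<dots> = ennreal (\<integral>x. std_normal_density x * (sym_shift_ratio b x)\<^sup>2 \<partial>lborel)"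
    by (rule nn_integral_eq_integral) (auto simp: std_normal_density_sq_ratio)
  also have "(\<integral>x. std_normal_density x * (sym_shift_ratio b x)\<^sup>2 \<partial>lborel) = cosh (b\<^sup>2)"
    by (simp add: std_normal_density_sq_ratio cosh_field_def)
  finally show ?thesis .
qed

lemma prob_space_PiM_std_gauss: "prob_space (PiM (K :: nat set) (\<lambda>_. std_gauss))"
  by (intro prob_space_PiM prob_space_std_gauss)

text \<open>
  With all shifts equal to \<open>b\<close>, the shifted vector may be replaced by one whose density \<open>L\<close> is the
  product of the coordinatewise mixture ratios. The error is at most the mean of \<open>\<bar>1 - L\<bar>\<close>, hence by
  Cauchy--Schwarz at most the square root of the chi-square divergence \<open>E L\<^sup>2 - 1\<close>, and \<open>E L\<^sup>2\<close> is a
  product of factors \<open>cosh (b\<^sup>2)\<close>.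
\<close>

lemma nn_integral_PiM_std_gauss_const_shift_ge:
  fixes h :: "real \<Rightarrow> ennreal" and K :: "nat set"
  assumes K: "finite K" and [measurable]: "h \<in> borel_measurable borel" and h: "\<And>q. h q \<le> 1"
  shows "(\<integral>\<^sup>+x. h (\<Sum>i\<in>K. (x i)\<^sup>2) \<partial>PiM K (\<lambda>_. std_gauss))
       \<le> (\<integral>\<^sup>+x. h (\<Sum>i\<in>K. (x i + b)\<^sup>2) \<partial>PiM K (\<lambda>_. std_gauss)) + ennreal (sqrt (cosh (b\<^sup>2) ^ card K - 1))"
proof -
  let ?P = "PiM K (\<lambda>_. std_gauss)"
  interpret P: prob_space ?P by (rule prob_space_PiM_std_gauss)
  define L where "L = (\<lambda>x. \<Prod>i\<in>K. sym_shift_ratio b (x i))"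
  have [measurable]: "L \<in> borel_measurable ?P" unfolding L_def by simp
  have L0: "L x \<ge> 0" for x by (simp add: L_def prod_nonneg)
  have "(\<integral>\<^sup>+x. ennreal (L x) \<partial>?P) = 1"
    using nn_integral_PiM_std_gauss_sym_shift[OF K, of "\<lambda>_. 1" b]
    by (simp add: L_def P.emeasure_space_1)
  then have L1: "has_bochner_integral ?P L 1"
    using L0 by (intro has_bochner_integral_nn_integral) auto
  have "(\<integral>\<^sup>+x. ennreal ((L x)\<^sup>2) \<partial>?P) = (\<integral>\<^sup>+x. (\<Prod>i\<in>K. ennreal ((sym_shift_ratio b (x i))\<^sup>2)) \<partial>?P)"
    by (simp add: L_def prod_power_distrib prod_ennreal)
  also have "\<dots> = ennreal (cosh (b\<^sup>2) ^ card K)"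
    using K by (subst std_gauss_PiM.product_nn_integral_prod) 
      (auto simp: nn_integral_sym_shift_ratio_sq ennreal_power)
  finally have L2: "has_bochner_integral ?P (\<lambda>x. (L x)\<^sup>2) (cosh (b\<^sup>2) ^ card K)"
    by (intro has_bochner_integral_nn_integral) auto
  have [simp]: "integrable ?P L" "integrable ?P (\<lambda>x. (L x)\<^sup>2)"
    using L1 L2 by (simp_all add: has_bochner_integral_iff)
  define X where "X = (\<lambda>x. \<bar>1 - L x\<bar>)"
  have [simp]: "integrable ?P X" by (simp add: X_def)
  have X2: "(X x)\<^sup>2 = 1 - 2 * L x + (L x)\<^sup>2" for x
    by (simp add: X_def power2_eq_square algebra_simps)
  have [simp]: "integrable ?P (\<lambda>x. (X x)\<^sup>2)" by (simp add: X2)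
  have "P.expectation (\<lambda>x. (X x)\<^sup>2) = cosh (b\<^sup>2) ^ card K - 1"
    using L1 L2 by (simp add: X2 has_bochner_integral_iff P.prob_space)
  moreover have "(P.expectation X)\<^sup>2 \<le> P.expectation (\<lambda>x. (X x)\<^sup>2)"
    using P.variance_positive[of X] by (subst (asm) P.variance_eq) auto
  ultimately have E: "P.expectation X \<le> sqrt (cosh (b\<^sup>2) ^ card K - 1)"
    by (intro real_le_rsqrt) simp
  have "(\<integral>\<^sup>+x. h (\<Sum>i\<in>K. (x i)\<^sup>2) \<partial>?P)
      \<le> (\<integral>\<^sup>+x. h (\<Sum>i\<in>K. (x i)\<^sup>2) * ennreal (L x) + ennreal (X x) \<partial>?P)"
  proof (rule nn_integral_mono)
    fix x
    let ?h = "h (\<Sum>i\<in>K. (x i)\<^sup>2)"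
    have "(1::ennreal) \<le> ennreal (L x) + ennreal (X x)"
      using L0 by (simp add: X_def ennreal_plus[symmetric] del: ennreal_plus)
    then have "?h * 1 \<le> ?h * (ennreal (L x) + ennreal (X x))" by (rule mult_left_mono) simp
    also have "\<dots> \<le> ?h * ennreal (L x) + 1 * ennreal (X x)"
      unfolding distrib_left by (intro add_left_mono mult_right_mono h) simp
    finally show "?h \<le> ?h * ennreal (L x) + ennreal (X x)" by simp
  qed
  also have "\<dots> = (\<integral>\<^sup>+x. h (\<Sum>i\<in>K. (x i)\<^sup>2) * ennreal (L x) \<partial>?P) + (\<integral>\<^sup>+x. ennreal (X x) \<partial>?P)"
    by (rule nn_integral_add) (auto simp: X_def)
  also have "(\<integral>\<^sup>+x. ennreal (X x) \<partial>?P) = ennreal (P.expectation X)"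
    by (rule nn_integral_eq_integral) (auto simp: X_def)
  also have "(\<integral>\<^sup>+x. h (\<Sum>i\<in>K. (x i)\<^sup>2) * ennreal (L x) \<partial>?P) = (\<integral>\<^sup>+x. h (\<Sum>i\<in>K. (x i + b)\<^sup>2) \<partial>?P)"
    by (simp add: L_def nn_integral_PiM_std_gauss_sym_shift[OF K])
  finally show ?thesis
    using E by (meson add_left_mono ennreal_leI order_trans)
qed

text \<open>
  This is Hoeffding's lemma for a fair random sign.
\<close>

lemma cosh_le_exp_half_sq: "cosh x \<le> exp (x\<^sup>2 / 2)" for x :: real
proof -
  have *: "cosh y \<le> exp (y\<^sup>2 / 2)" if "y \<ge> 0" for y :: real
  proof -
    have "ln (1 + 1 / 2 * (exp (2 * y) - 1)) \<le> y + y\<^sup>2 / 2"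
      using Hoeffdings_lemma_aux[of "2 * y" "1 / 2"] that by (simp add: power_mult_distrib)
    moreover have pos: "0 < 1 + 1 / 2 * (exp (2 * y) - 1)"
      using exp_gt_zero[of "2 * y"] by (simp add: field_simps del: exp_gt_zero)
    ultimately have "1 + 1 / 2 * (exp (2 * y) - 1) \<le> exp (y + y\<^sup>2 / 2)"
      by (metis exp_le_cancel_iff exp_ln)
    also have "1 + 1 / 2 * (exp (2 * y) - 1) = exp y * cosh y"
      by (simp add: cosh_field_def field_simps mult_exp_exp)
    finally show ?thesis by (simp add: exp_add)
  qed
  show ?thesis using *[of x] *[of "- x"] by (cases "x \<ge> 0") auto
qed

text \<open>
  An arbitrary shift may be replaced by the constant one of the same norm. The resulting bound is small
  as soon as the squared norm of \<open>c\<close> is small compared with the square root of the dimension: this is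
  the detection threshold of the chi-square statistic, and the origin of \<open>sqrt D\<close> in the theorem.
\<close>

lemma nn_integral_PiM_std_gauss_shift_ge:
  fixes h :: "real \<Rightarrow> ennreal" and K :: "nat set" and c :: "nat \<Rightarrow> real"
  assumes K: "finite K" "K \<noteq> {}" and [measurable]: "h \<in> borel_measurable borel" and h: "\<And>q. h q \<le> 1"
  shows "(\<integral>\<^sup>+x. h (\<Sum>i\<in>K. (x i)\<^sup>2) \<partial>PiM K (\<lambda>_. std_gauss))
       \<le> (\<integral>\<^sup>+x. h (\<Sum>i\<in>K. (x i + c i)\<^sup>2) \<partial>PiM K (\<lambda>_. std_gauss))
         + ennreal (sqrt (exp ((\<Sum>i\<in>K. (c i)\<^sup>2)\<^sup>2 / (2 * real (card K))) - 1))"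
proof -
  define n where "n = card K"
  have n: "n > 0" using K by (simp add: n_def card_gt_0_iff)
  \<comment> \<open>the constant shift with the same Euclidean norm as \<open>c\<close>\<close>
  define b where "b = sqrt ((\<Sum>i\<in>K. (c i)\<^sup>2) / real n)"
  have b2: "b\<^sup>2 = (\<Sum>i\<in>K. (c i)\<^sup>2) / real n"
    by (simp add: b_def sum_nonneg)
  obtain j J where J: "K = insert j J" "j \<notin> J" "finite J"
    using K by (metis finite_insert mk_disjoint_insert all_not_in_conv)
  have "(\<Sum>i\<in>K. b\<^sup>2) = (\<Sum>i\<in>K. (c i)\<^sup>2)" using n by (simp add: b2 n_def)
  then have eq: "(\<integral>\<^sup>+x. h (\<Sum>i\<in>K. (x i + b)\<^sup>2) \<partial>PiM K (\<lambda>_. std_gauss))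
      = (\<integral>\<^sup>+x. h (\<Sum>i\<in>K. (x i + c i)\<^sup>2) \<partial>PiM K (\<lambda>_. std_gauss))"
    unfolding J(1) using J
    by (subst (1 2) nn_integral_PiM_std_gauss_norm_shift) (auto simp del: sum.insert sum_constant)
  have "cosh (b\<^sup>2) ^ n \<le> exp ((b\<^sup>2)\<^sup>2 / 2) ^ n"
    by (intro power_mono cosh_le_exp_half_sq) simp
  also have "\<dots> = exp ((\<Sum>i\<in>K. (c i)\<^sup>2)\<^sup>2 / (2 * real n))"
    using n by (simp add: b2 exp_of_nat_mult[symmetric] power_divide) (simp add: power2_eq_square)
  finally have "sqrt (cosh (b\<^sup>2) ^ n - 1) \<le> sqrt (exp ((\<Sum>i\<in>K. (c i)\<^sup>2)\<^sup>2 / (2 * real n)) - 1)"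
    by simp
  then show ?thesis
    using nn_integral_PiM_std_gauss_const_shift_ge[OF K(1) assms(3) h, of b]
    unfolding eq n_def by (meson add_left_mono ennreal_leI order_trans)
qed

section \<open>Undetectability of a tail signal in the residual filtration\<close>

lemma space_data_space: "space (data_space D) = {1..D} \<rightarrow>\<^sub>E UNIV"
  by (simp add: data_space_def space_PiM)

lemma measurable_data_space_component: "(\<lambda>y. y i) \<in> borel_measurable (data_space D)"
  if "i \<in> {1..D}"
  using that unfolding data_space_def by simp

lemma borel_measurable_L2_set_data_space [measurable]:
  "(\<lambda>y. (L2_set y {1..D})\<^sup>2) \<in> borel_measurable (data_space D)"
  unfolding data_space_def L2_set_def by measurable

lemma sets_residual_filtration:
  "sets (residual_filtration D m) = sigma_sets (space (data_space D))
     ({(\<lambda>y. y i) -` B \<inter> space (data_space D) | i B. i \<in> {1..min m D} \<and> B \<in> sets borel} \<union>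
      {(\<lambda>y. (L2_set y {1..D})\<^sup>2) -` B \<inter> space (data_space D) | B. B \<in> sets borel})"
  unfolding residual_filtration_def by (rule sets_measure_of) auto

lemma sets_residual_filtration_subset: "sets (residual_filtration D m) \<subseteq> sets (data_space D)"
  unfolding sets_residual_filtration
proof (rule sets.sigma_sets_subset, safe)
  fix i and B :: "real set" assume "i \<in> {1..min m D}" and B: "B \<in> sets borel"
  then have "i \<in> {1..D}" by auto
  then show "(\<lambda>y. y i) -` B \<inter> space (data_space D) \<in> sets (data_space D)"
    by (rule measurable_sets[OF measurable_data_space_component B])
qed (rule measurable_sets[OF borel_measurable_L2_set_data_space])

text \<open>
  Events of the residual filtration are those that can be decided from the first \<open>m\<close> observations and
  the squared norm; both kinds of generators are of this form, and preimages under a fixed map form a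
  sigma-algebra.
\<close>

lemma residual_filtration_factor:
  assumes "A \<in> sets (residual_filtration D m)" "m \<le> D"
  obtains B where "B \<in> sets (PiM {1..m} (\<lambda>_. borel) \<Otimes>\<^sub>M borel)"
    "A = (\<lambda>y. (restrict y {1..m}, (L2_set y {1..D})\<^sup>2)) -` B \<inter> space (data_space D)"
proof -
  let ?S = "PiM {1..m} (\<lambda>_. borel :: real measure) \<Otimes>\<^sub>M (borel :: real measure)"
  let ?T = "\<lambda>y. (restrict y {1..m}, (L2_set y {1..D})\<^sup>2)"
  let ?V = "vimage_algebra (space (data_space D)) ?T ?S"
  have T: "?T \<in> space (data_space D) \<rightarrow> space ?S"
    by (auto simp: space_pair_measure space_PiM)
  have T_meas [measurable]: "?T \<in> measurable ?V ?S"
    by (rule measurable_vimage_algebra1[OF T])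
  have "sets (residual_filtration D m) \<subseteq> sets ?V"
    unfolding sets_residual_filtration
  proof (rule sets.sigma_sets_subset[of _ ?V, unfolded space_vimage_algebra])
    show "{(\<lambda>y. y i) -` B \<inter> space (data_space D) | i B. i \<in> {1..min m D} \<and> B \<in> sets borel} \<union>
      {(\<lambda>y. (L2_set y {1..D})\<^sup>2) -` B \<inter> space (data_space D) | B. B \<in> sets borel} \<subseteq> sets ?V"
    proof safe
      fix i and B :: "real set" assume i: "i \<in> {1..min m D}" and B: "B \<in> sets borel"
      have "(\<lambda>y. fst (?T y) i) \<in> borel_measurable ?V"
        using i by (intro measurable_compose[OF T_meas]) simp
      then have "(\<lambda>y. y i) \<in> borel_measurable ?V" using i by simp
      from measurable_sets[OF this B]
      show "(\<lambda>y. y i) -` B \<inter> space (data_space D) \<in> sets ?V" by simp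
    next
      fix B :: "real set" assume B: "B \<in> sets borel"
      have "(\<lambda>y. snd (?T y)) \<in> borel_measurable ?V"
        by (intro measurable_compose[OF T_meas]) simp
      from measurable_sets[OF this B]
      show "(\<lambda>y. (L2_set y {1..D})\<^sup>2) -` B \<inter> space (data_space D) \<in> sets ?V" by simp
    qed
  qed
  then have "A \<in> {?T -` B \<inter> space (data_space D) | B. B \<in> sets ?S}"
    using assms(1) unfolding sets_vimage_algebra2[OF T] by auto
  then show ?thesis using that by auto
qed

lemma prob_space_white_noise: "prob_space (white_noise D)"
  unfolding white_noise_def by (rule prob_space_PiM_std_gauss)

lemma measurable_observation [measurable]:
  "observation D lam \<delta> \<mu> \<in> measurable (white_noise D) (data_space D)"
  unfolding observation_def white_noise_def data_space_def
  by (rule measurable_restrict) simp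

lemma sets_data_law [measurable_cong, simp]: "sets (data_law D lam \<delta> \<mu>) = sets (data_space D)"
  by (simp add: data_law_def)

lemma space_data_law [simp]: "space (data_law D lam \<delta> \<mu>) = space (data_space D)"
  by (simp add: data_law_def)

lemma prob_space_data_law: "prob_space (data_law D lam \<delta> \<mu>)"
  unfolding data_law_def
  by (rule prob_space.prob_space_distr[OF prob_space_white_noise]) measurable

text \<open>
  The noise is split into its first \<open>m\<close> coordinates \<open>x\<close> and the remaining ones \<open>y\<close>. For fixed \<open>x\<close>, an
  event of the filtration depends on \<open>y\<close> only through the tail energy.
\<close>

lemma emeasure_data_law_residual:
  assumes m: "m \<le> D" and \<delta>: "\<delta> > 0" and B [measurable]: "B \<in> sets (PiM {1..m} (\<lambda>_. borel) \<Otimes>\<^sub>M borel)"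
  shows "emeasure (data_law D lam \<delta> \<mu>)
      ((\<lambda>y. (restrict y {1..m}, (L2_set y {1..D})\<^sup>2)) -` B \<inter> space (data_space D))
    = (\<integral>\<^sup>+x. \<integral>\<^sup>+y. indicator B
        (\<lambda>i\<in>{1..m}. lam i * \<mu> i + \<delta> * x i,
         (\<Sum>i\<in>{1..m}. (lam i * \<mu> i + \<delta> * x i)\<^sup>2)
           + \<delta>\<^sup>2 * (\<Sum>i\<in>{m<..D}. (y i + lam i * \<mu> i / \<delta>)\<^sup>2))
       \<partial>PiM {m<..D} (\<lambda>_. std_gauss) \<partial>PiM {1..m} (\<lambda>_. std_gauss))"
proof -
  let ?T = "\<lambda>y. (restrict y {1..m}, (L2_set y {1..D})\<^sup>2)"
  let ?O = "observation D lam \<delta> \<mu>"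
  have un: "{1..D} = {1..m} \<union> {m<..D}" and dj: "{1..m} \<inter> {m<..D} = {}" using m by auto
  have T [measurable]: "?T \<in> measurable (data_space D) (PiM {1..m} (\<lambda>_. borel) \<Otimes>\<^sub>M borel)"
  proof (rule measurable_Pair)
    show "(\<lambda>y. restrict y {1..m}) \<in> measurable (data_space D) (PiM {1..m} (\<lambda>_. borel))"
      using m unfolding data_space_def by (intro measurable_restrict_subset) auto
  qed (rule borel_measurable_L2_set_data_space)
  have "emeasure (data_law D lam \<delta> \<mu>) (?T -` B \<inter> space (data_space D))
      = (\<integral>\<^sup>+y. indicator (?T -` B \<inter> space (data_space D)) y \<partial>data_law D lam \<delta> \<mu>)"
    using measurable_sets[OF T B] by (simp add: nn_integral_indicator)
  also have "\<dots> = (\<integral>\<^sup>+\<epsilon>. indicator (?T -` B \<inter> space (data_space D)) (?O \<epsilon>) \<partial>white_noise D)"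
    using measurable_sets[OF T B] unfolding data_law_def by (intro nn_integral_distr) auto
  also have "\<dots> = (\<integral>\<^sup>+\<epsilon>. indicator B (?T (?O \<epsilon>)) \<partial>white_noise D)"
    by (intro nn_integral_cong) (auto simp: indicator_def space_data_space observation_def)
  also have "\<dots> = (\<integral>\<^sup>+x. \<integral>\<^sup>+y. indicator B (?T (?O (merge {1..m} {m<..D} (x, y))))
      \<partial>PiM {m<..D} (\<lambda>_. std_gauss) \<partial>PiM {1..m} (\<lambda>_. std_gauss))"
  proof -
    have "(\<lambda>\<epsilon>. indicator B (?T (?O \<epsilon>)) :: ennreal) \<in> borel_measurable (white_noise D)"
      by measurable
    then show ?thesis
      unfolding white_noise_def un by (intro std_gauss_PiM.product_nn_integral_fold dj) auto
  qed
  also have "\<dots> = (\<integral>\<^sup>+x. \<integral>\<^sup>+y. indicator B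
        (\<lambda>i\<in>{1..m}. lam i * \<mu> i + \<delta> * x i,
         (\<Sum>i\<in>{1..m}. (lam i * \<mu> i + \<delta> * x i)\<^sup>2)
           + \<delta>\<^sup>2 * (\<Sum>i\<in>{m<..D}. (y i + lam i * \<mu> i / \<delta>)\<^sup>2))
       \<partial>PiM {m<..D} (\<lambda>_. std_gauss) \<partial>PiM {1..m} (\<lambda>_. std_gauss))"
  proof (intro nn_integral_cong arg_cong[where f = "indicator B"] arg_cong2[where f = Pair])
    fix x y :: "nat \<Rightarrow> real"
    let ?z = "?O (merge {1..m} {m<..D} (x, y))"
    show "restrict ?z {1..m} = (\<lambda>i\<in>{1..m}. lam i * \<mu> i + \<delta> * x i)"
      using m by (auto simp: observation_def fun_eq_iff merge_def)
    have "(L2_set ?z {1..D})\<^sup>2 = (\<Sum>i\<in>{1..m}. (?z i)\<^sup>2) + (\<Sum>i\<in>{m<..D}. (?z i)\<^sup>2)"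
      unfolding L2_set_def un by (subst sum.union_disjoint[symmetric]) (auto simp: sum_nonneg)
    also have "(\<Sum>i\<in>{1..m}. (?z i)\<^sup>2) = (\<Sum>i\<in>{1..m}. (lam i * \<mu> i + \<delta> * x i)\<^sup>2)"
      using m by (intro sum.cong) (auto simp: observation_def merge_def)
    also have "(\<Sum>i\<in>{m<..D}. (?z i)\<^sup>2) = \<delta>\<^sup>2 * (\<Sum>i\<in>{m<..D}. (y i + lam i * \<mu> i / \<delta>)\<^sup>2)"
      unfolding sum_distrib_left power_mult_distrib[symmetric] using \<delta>
      by (intro sum.cong arg_cong[where f = "\<lambda>a. a\<^sup>2"])
         (auto simp: observation_def merge_def field_simps)
    finally show "(L2_set ?z {1..D})\<^sup>2 = (\<Sum>i\<in>{1..m}. (lam i * \<mu> i + \<delta> * x i)\<^sup>2)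
           + \<delta>\<^sup>2 * (\<Sum>i\<in>{m<..D}. (y i + lam i * \<mu> i / \<delta>)\<^sup>2)" .
  qed
  finally show ?thesis .
qed

text \<open>
  At time \<open>m\<close> the rule sees the coordinates behind \<open>m\<close> only through their total energy, so a signal
  that lives there is undetected unless its energy, in units of \<open>\<delta>\<^sup>2\<close>, reaches the order of
  \<open>sqrt (D - m)\<close>. The bound for the tail energy is applied conditionally on the first \<open>m\<close> coordinates.
\<close>

lemma data_law_residual_indistinguishable:
  assumes m: "m < D" and \<delta>: "\<delta> > 0" and A: "A \<in> sets (residual_filtration D m)"
    and head: "\<And>i. i \<in> {1..m} \<Longrightarrow> \<mu> i = \<nu> i" and tail: "\<And>i. i \<in> {m<..D} \<Longrightarrow> \<mu> i = 0"
  shows "measure (data_law D lam \<delta> \<mu>) A \<le> measure (data_law D lam \<delta> \<nu>) A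
    + sqrt (exp ((\<Sum>i\<in>{m<..D}. (lam i * \<nu> i / \<delta>)\<^sup>2)\<^sup>2 / (2 * real (D - m))) - 1)"
proof -
  let ?e = "sqrt (exp ((\<Sum>i\<in>{m<..D}. (lam i * \<nu> i / \<delta>)\<^sup>2)\<^sup>2 / (2 * real (D - m))) - 1)"
  interpret P: prob_space "data_law D lam \<delta> \<mu>" by (rule prob_space_data_law)
  interpret Q: prob_space "data_law D lam \<delta> \<nu>" by (rule prob_space_data_law)
  interpret H: prob_space "PiM {1..m} (\<lambda>_. std_gauss)" by (rule prob_space_PiM_std_gauss)
  obtain B where B [measurable]: "B \<in> sets (PiM {1..m} (\<lambda>_. borel) \<Otimes>\<^sub>M borel)"
    and AB: "A = (\<lambda>y. (restrict y {1..m}, (L2_set y {1..D})\<^sup>2)) -` B \<inter> space (data_space D)"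
    by (rule residual_filtration_factor[OF A less_imp_le[OF m]])
  have head': "(\<lambda>i\<in>{1..m}. lam i * \<mu> i + \<delta> * x i) = (\<lambda>i\<in>{1..m}. lam i * \<nu> i + \<delta> * x i)"
    "(\<Sum>i\<in>{1..m}. (lam i * \<mu> i + \<delta> * x i)\<^sup>2) = (\<Sum>i\<in>{1..m}. (lam i * \<nu> i + \<delta> * x i)\<^sup>2)" for x
    using head by (auto intro: sum.cong restrict_ext)
  have tail': "(\<Sum>i\<in>{m<..D}. (y i + lam i * \<mu> i / \<delta>)\<^sup>2) = (\<Sum>i\<in>{m<..D}. (y i)\<^sup>2)" for y
    using tail by (intro sum.cong) auto
  define h where "h = (\<lambda>x q. indicator B (\<lambda>i\<in>{1..m}. lam i * \<nu> i + \<delta> * x i,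
         (\<Sum>i\<in>{1..m}. (lam i * \<nu> i + \<delta> * x i)\<^sup>2) + \<delta>\<^sup>2 * q) :: ennreal)"
  have hm [measurable]: "(\<lambda>(x, q). h x q) \<in> borel_measurable (PiM {1..m} (\<lambda>_. std_gauss) \<Otimes>\<^sub>M borel)"
    unfolding h_def by measurable
  have "emeasure (data_law D lam \<delta> \<mu>) A
      = (\<integral>\<^sup>+x. \<integral>\<^sup>+y. h x (\<Sum>i\<in>{m<..D}. (y i)\<^sup>2) \<partial>PiM {m<..D} (\<lambda>_. std_gauss) \<partial>PiM {1..m} (\<lambda>_. std_gauss))"
    unfolding AB emeasure_data_law_residual[OF less_imp_le[OF m] \<delta> B] head' tail' h_def ..
  also have "\<dots> \<le> (\<integral>\<^sup>+x. (\<integral>\<^sup>+y. h x (\<Sum>i\<in>{m<..D}. (y i + lam i * \<nu> i / \<delta>)\<^sup>2) \<partial>PiM {m<..D} (\<lambda>_. std_gauss))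
       + ennreal ?e \<partial>PiM {1..m} (\<lambda>_. std_gauss))"
  proof (rule nn_integral_mono)
    fix x :: "nat \<Rightarrow> real" assume x: "x \<in> space (PiM {1..m} (\<lambda>_. std_gauss))"
    have "h x \<in> borel_measurable borel"
      using measurable_Pair2[OF hm x] by simp
    moreover have "h x q \<le> 1" for q by (simp add: h_def indicator_def)
    ultimately show "(\<integral>\<^sup>+y. h x (\<Sum>i\<in>{m<..D}. (y i)\<^sup>2) \<partial>PiM {m<..D} (\<lambda>_. std_gauss))
       \<le> (\<integral>\<^sup>+y. h x (\<Sum>i\<in>{m<..D}. (y i + lam i * \<nu> i / \<delta>)\<^sup>2) \<partial>PiM {m<..D} (\<lambda>_. std_gauss)) + ennreal ?e"
      using nn_integral_PiM_std_gauss_shift_ge[of "{m<..D}" "h x" "\<lambda>i. lam i * \<nu> i / \<delta>"] m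
      by simp
  qed
  also have "\<dots> = (\<integral>\<^sup>+x. \<integral>\<^sup>+y. h x (\<Sum>i\<in>{m<..D}. (y i + lam i * \<nu> i / \<delta>)\<^sup>2) \<partial>PiM {m<..D} (\<lambda>_. std_gauss) \<partial>PiM {1..m} (\<lambda>_. std_gauss)) + ennreal ?e"
  proof (subst nn_integral_add)
    interpret J: finite_product_sigma_finite "\<lambda>_::nat. std_gauss" "{m<..D}" by standard auto
    show "(\<lambda>x. \<integral>\<^sup>+y. h x (\<Sum>i\<in>{m<..D}. (y i + lam i * \<nu> i / \<delta>)\<^sup>2) \<partial>PiM {m<..D} (\<lambda>_. std_gauss))
       \<in> borel_measurable (PiM {1..m} (\<lambda>_. std_gauss))" by measurable
  qed (simp_all add: H.emeasure_space_1 del: One_nat_def)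
  also have "(\<integral>\<^sup>+x. \<integral>\<^sup>+y. h x (\<Sum>i\<in>{m<..D}. (y i + lam i * \<nu> i / \<delta>)\<^sup>2) \<partial>PiM {m<..D} (\<lambda>_. std_gauss) \<partial>PiM {1..m} (\<lambda>_. std_gauss))
      = emeasure (data_law D lam \<delta> \<nu>) A"
    unfolding AB emeasure_data_law_residual[OF less_imp_le[OF m] \<delta> B] h_def ..
  finally have "ennreal (P.prob A) \<le> ennreal (Q.prob A + ?e)"
    by (simp add: P.emeasure_eq_measure Q.emeasure_eq_measure)
  then show ?thesis
    by (subst (asm) ennreal_le_iff) auto
qed

section \<open>Lower bounds for the risk of a stopped estimator\<close>

lemma pred_stopping_time:
  assumes "stopping_time (residual_filtration D) T"
  shows "Measurable.pred (data_space D) (\<lambda>y. T y < i)" "Measurable.pred (data_space D) (\<lambda>y. i \<le> T y)"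
proof -
  have *: "Measurable.pred (data_space D) (\<lambda>y. T y \<le> k)" for k
    using stopping_timeD[OF assms, of k] sets_residual_filtration_subset[of D k]
      filtration.space_F[OF filtration_residual, of D k]
    by (auto simp: Measurable.pred_def)
  show lt: "Measurable.pred (data_space D) (\<lambda>y. T y < i)"
  proof (cases i)
    case (Suc k)
    then show ?thesis using *[of k] by (simp add: less_Suc_eq_le)
  qed simp
  then show "Measurable.pred (data_space D) (\<lambda>y. i \<le> T y)"
    unfolding not_less[symmetric] by (rule pred_intros_logic)
qed

lemma measurable_white_noise_component:
  "i \<in> {1..D} \<Longrightarrow> (\<lambda>\<epsilon>. \<epsilon> i) \<in> measurable (white_noise D) std_gauss"
  unfolding white_noise_def by (rule measurable_component_singleton)

lemma distr_white_noise_component: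
  assumes "i \<in> {1..D}"
  shows "distr (white_noise D) std_gauss (\<lambda>\<epsilon>. \<epsilon> i) = std_gauss"
  unfolding white_noise_def using assms
  by (intro distr_PiM_component) (auto intro: prob_space_std_gauss)

lemma measure_std_gauss_interval_le:
  assumes "h \<ge> 0"
  shows "measure std_gauss {-h..h} \<le> h"
proof -
  have "2 \<le> sqrt (2 * pi)"
    using pi_gt3 by (intro real_le_rsqrt) simp
  then have "1 / sqrt (2 * pi) \<le> 1 / 2"
    by (simp add: field_simps)
  then have "1 / sqrt (2 * pi) * exp (- x\<^sup>2 / 2) \<le> 1 / 2 * 1" for x
    by (intro mult_mono) auto
  then have d: "std_normal_density x \<le> 1 / 2" for x
    by (simp add: std_normal_density_def)
  have "emeasure std_gauss {-h..h} = (\<integral>\<^sup>+x\<in>{-h..h}. ennreal (std_normal_density x) \<partial>lborel)"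
    by (subst emeasure_density) auto
  also have "\<dots> \<le> (\<integral>\<^sup>+x\<in>{-h..h}. ennreal (1 / 2) \<partial>lborel)"
    using d by (intro nn_integral_mono mult_right_mono ennreal_leI) auto
  also have "\<dots> = ennreal (1 / 2) * ennreal (2 * h)"
    using assms by (subst nn_integral_cmult_indicator) simp_all
  also have "\<dots> = ennreal (1 / 2 * (2 * h))"
    using assms by (intro ennreal_mult[symmetric]) simp_all
  finally show ?thesis
    using assms by (simp add: std_gauss.emeasure_eq_measure)
qed

lemma data_law_deviation_le:
  assumes i: "i \<in> {1..D}" and h: "h \<ge> 0" and \<delta>: "\<delta> > 0"
  shows "measure (data_law D lam \<delta> \<mu>) {y \<in> space (data_space D). \<bar>y i - lam i * \<mu> i\<bar> \<le> \<delta> * h} \<le> h"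
proof -
  note [measurable] = measurable_data_space_component[OF i]
  have "measure (data_law D lam \<delta> \<mu>) {y \<in> space (data_space D). \<bar>y i - lam i * \<mu> i\<bar> \<le> \<delta> * h}
     = measure (white_noise D) (observation D lam \<delta> \<mu> -` {y \<in> space (data_space D). \<bar>y i - lam i * \<mu> i\<bar> \<le> \<delta> * h} \<inter> space (white_noise D))"
    unfolding data_law_def by (rule measure_distr) measurable
  also have "observation D lam \<delta> \<mu> -` {y \<in> space (data_space D). \<bar>y i - lam i * \<mu> i\<bar> \<le> \<delta> * h} \<inter> space (white_noise D)
     = (\<lambda>\<epsilon>. \<epsilon> i) -` {-h..h} \<inter> space (white_noise D)"
  proof -
    have "\<bar>\<delta> * e\<bar> \<le> \<delta> * h \<longleftrightarrow> e \<in> {-h..h}" for e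
      using \<delta> by (simp add: abs_mult) (auto simp: abs_le_iff)
    then have "(\<lambda>\<epsilon>. \<epsilon> i) -` {-h..h} \<inter> space (white_noise D) = {\<epsilon> \<in> space (white_noise D). \<bar>\<delta> * \<epsilon> i\<bar> \<le> \<delta> * h}"
      unfolding set_eq_iff by blast
    also have "\<dots> = observation D lam \<delta> \<mu> -` {y \<in> space (data_space D). \<bar>y i - lam i * \<mu> i\<bar> \<le> \<delta> * h} \<inter> space (white_noise D)"
      using i by (auto simp: observation_def space_data_space)
    finally show ?thesis by simp
  qed
  also have "measure (white_noise D) \<dots> = measure (distr (white_noise D) std_gauss (\<lambda>\<epsilon>. \<epsilon> i)) {-h..h}"
    by (rule measure_distr[OF measurable_white_noise_component[OF i], symmetric]) simp
  also have "\<dots> \<le> h"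
    unfolding distr_white_noise_component[OF i] by (rule measure_std_gauss_interval_le[OF h])
  finally show ?thesis .
qed

lemma integrable_data_law_sq:
  assumes i: "i \<in> {1..D}"
  shows "integrable (data_law D lam \<delta> \<mu>) (\<lambda>y. (y i)\<^sup>2)"
proof -
  note [measurable] = measurable_data_space_component[OF i]
  have k: "integrable (white_noise D) (\<lambda>\<epsilon>. \<epsilon> i ^ k)" for k
  proof -
    have "integrable std_gauss (\<lambda>x. x ^ k)"
      using integrable_std_normal_moment[of k] by (subst integrable_density) (auto simp: mult.commute)
    then have "integrable (distr (white_noise D) std_gauss (\<lambda>\<epsilon>. \<epsilon> i)) (\<lambda>x. x ^ k)"
      unfolding distr_white_noise_component[OF i] .
    then show ?thesis by (rule integrable_distr[OF measurable_white_noise_component[OF i]])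
  qed
  interpret W: prob_space "white_noise D" by (rule prob_space_white_noise)
  have "integrable (white_noise D) (\<lambda>\<epsilon>. (lam i * \<mu> i)\<^sup>2 + 2 * (lam i * \<mu> i) * \<delta> * \<epsilon> i ^ 1 + \<delta>\<^sup>2 * \<epsilon> i ^ 2)"
    by (intro Bochner_Integration.integrable_add integrable_mult_right k) simp
  also have "(\<lambda>\<epsilon>. (lam i * \<mu> i)\<^sup>2 + 2 * (lam i * \<mu> i) * \<delta> * \<epsilon> i ^ 1 + \<delta>\<^sup>2 * \<epsilon> i ^ 2)
      = (\<lambda>\<epsilon>. (observation D lam \<delta> \<mu> \<epsilon> i)\<^sup>2)"
    using i by (auto simp: observation_def power2_eq_square algebra_simps)
  finally show ?thesis
    unfolding data_law_def by (subst integrable_distr_eq) auto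
qed

definition coord_loss ::
  "(nat \<Rightarrow> real) \<Rightarrow> (nat \<Rightarrow> real) \<Rightarrow> ((nat \<Rightarrow> real) \<Rightarrow> nat) \<Rightarrow> nat \<Rightarrow> (nat \<Rightarrow> real) \<Rightarrow> real"
where
  "coord_loss lam \<mu> T i y = (of_bool (i \<le> T y) * inverse (lam i) * y i - \<mu> i)\<^sup>2"

lemma coord_loss_nonneg [simp]: "coord_loss lam \<mu> T i y \<ge> 0"
  unfolding coord_loss_def by (rule zero_le_power2)

lemma integrable_coord_loss:
  assumes T: "stopping_time (residual_filtration D) T" and i: "i \<in> {1..D}"
  shows "integrable (data_law D lam \<delta> \<mu>) (coord_loss lam \<mu> T i)"
proof -
  interpret P: prob_space "data_law D lam \<delta> \<mu>" by (rule prob_space_data_law)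
  note [measurable] = pred_stopping_time[OF T] measurable_data_space_component[OF i]
  have "integrable (data_law D lam \<delta> \<mu>) (\<lambda>y. 2 * (inverse (lam i))\<^sup>2 * (y i)\<^sup>2 + 2 * (\<mu> i)\<^sup>2)"
    by (intro Bochner_Integration.integrable_add integrable_mult_right integrable_data_law_sq[OF i]) simp
  then show ?thesis
  proof (rule Bochner_Integration.integrable_bound)
    show "coord_loss lam \<mu> T i \<in> borel_measurable (data_law D lam \<delta> \<mu>)"
      unfolding coord_loss_def by measurable
    have "coord_loss lam \<mu> T i y \<le> 2 * (inverse (lam i))\<^sup>2 * (y i)\<^sup>2 + 2 * (\<mu> i)\<^sup>2" for y
    proof -
      have "(a - b)\<^sup>2 \<le> 2 * a\<^sup>2 + 2 * b\<^sup>2" for a b :: real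
        using zero_le_power2[of "a + b"] by (simp add: power2_eq_square algebra_simps)
      from this[of "of_bool (i \<le> T y) * inverse (lam i) * y i" "\<mu> i"]
      show ?thesis
        by (auto simp: coord_loss_def power_mult_distrib intro: order_trans)
    qed
    then show "AE y in data_law D lam \<delta> \<mu>. norm (coord_loss lam \<mu> T i y)
        \<le> norm (2 * (inverse (lam i))\<^sup>2 * (y i)\<^sup>2 + 2 * (\<mu> i)\<^sup>2)"
      by (intro AE_I2) simp
  qed
qed

text \<open>
  The integrability of the coordinatewise losses is essential here: the risk is defined by a Bochner
  integral, which is 0 for a function that is not integrable.
\<close>

lemma risk_sq_eq_sum:
  assumes T: "stopping_time (residual_filtration D) T"
  shows "(risk D lam \<delta> \<mu> T)\<^sup>2 = (\<Sum>i=1..D. \<integral>y. coord_loss lam \<mu> T i y \<partial>data_law D lam \<delta> \<mu>)"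
proof -
  have "(L2_set (\<lambda>i. tsvd_estimator D lam (T y) y i - \<mu> i) {1..D})\<^sup>2 = (\<Sum>i=1..D. coord_loss lam \<mu> T i y)" for y
    by (simp add: L2_set_def sum_nonneg coord_loss_def tsvd_estimator_def)
  then show ?thesis
    unfolding risk_def using integrable_coord_loss[OF T]
    by (simp add: Bochner_Integration.integral_sum sum_nonneg)
qed

lemma integral_coord_loss_ge:
  assumes T: "stopping_time (residual_filtration D) T" and i: "i \<in> {1..D}"
    and E: "E \<in> sets (data_space D)" and c: "\<And>y. y \<in> E \<Longrightarrow> c \<le> coord_loss lam \<mu> T i y"
  shows "c * measure (data_law D lam \<delta> \<mu>) E \<le> (\<integral>y. coord_loss lam \<mu> T i y \<partial>data_law D lam \<delta> \<mu>)"
proof -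
  interpret P: prob_space "data_law D lam \<delta> \<mu>" by (rule prob_space_data_law)
  have E': "E \<in> P.events" using E by simp
  then have "c * P.prob E = (\<integral>y. c * indicator E y \<partial>data_law D lam \<delta> \<mu>)"
    using sets.sets_into_space[OF E] by (simp add: Int_absorb2)
  also have "\<dots> \<le> (\<integral>y. coord_loss lam \<mu> T i y \<partial>data_law D lam \<delta> \<mu>)"
    using c E' by (intro integral_mono integrable_coord_loss[OF T i] integrable_mult_right
      integrable_real_indicator) (auto simp: indicator_def coord_loss_def P.emeasure_eq_measure)
  finally show ?thesis .
qed

text \<open>
  Stopping before \<open>i\<close> estimates the coordinate \<open>i\<close> by 0.
\<close>

lemma risk_sq_ge_bias:
  assumes T: "stopping_time (residual_filtration D) T" and i: "i \<in> {1..D}"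
  shows "(\<mu> i)\<^sup>2 * measure (data_law D lam \<delta> \<mu>) {y \<in> space (data_space D). T y < i} \<le> (risk D lam \<delta> \<mu> T)\<^sup>2"
proof -
  note [measurable] = pred_stopping_time[OF T]
  have "(\<mu> i)\<^sup>2 * measure (data_law D lam \<delta> \<mu>) {y \<in> space (data_space D). T y < i}
      \<le> (\<integral>y. coord_loss lam \<mu> T i y \<partial>data_law D lam \<delta> \<mu>)"
    by (rule integral_coord_loss_ge[OF T i]) (auto simp: coord_loss_def)
  also have "\<dots> \<le> (risk D lam \<delta> \<mu> T)\<^sup>2"
    unfolding risk_sq_eq_sum[OF T] using i
    by (intro member_le_sum) auto
  finally show ?thesis .
qed

text \<open>
  If the rule runs until \<open>k\<close>, each coordinate \<open>i \<le> k\<close> contributes the loss \<open>(\<delta> \<epsilon> i / lam i)\<^sup>2\<close>. The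
  rule may depend on the noise, but \<open>\<bar>\<epsilon> i\<bar> \<le> h\<close> has probability at most \<open>h\<close>, which can hide only a part
  \<open>h\<close> of the event of late stopping. Since the coordinates are treated one by one, the law of a single
  Gaussian variable is all that enters.
\<close>

lemma risk_sq_ge_noise:
  assumes T: "stopping_time (residual_filtration D) T" and k: "k \<le> D" and h: "h \<ge> 0" and \<delta>: "\<delta> > 0"
    and lam: "\<And>i. i \<in> {1..D} \<Longrightarrow> lam i > 0"
  shows "(\<Sum>i=1..k. (\<delta> * h / lam i)\<^sup>2) * (measure (data_law D lam \<delta> \<mu>) {y \<in> space (data_space D). k \<le> T y} - h)
    \<le> (risk D lam \<delta> \<mu> T)\<^sup>2"
proof -
  interpret P: prob_space "data_law D lam \<delta> \<mu>" by (rule prob_space_data_law)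
  note [measurable] = pred_stopping_time[OF T]
  let ?A = "{y \<in> space (data_space D). k \<le> T y}"
  have "(\<delta> * h / lam i)\<^sup>2 * (P.prob ?A - h) \<le> (\<integral>y. coord_loss lam \<mu> T i y \<partial>data_law D lam \<delta> \<mu>)"
    if i: "i \<in> {1..k}" for i
  proof -
    have iD: "i \<in> {1..D}" using i k by auto
    note [measurable] = measurable_data_space_component[OF iD]
    let ?N = "{y \<in> space (data_space D). \<bar>y i - lam i * \<mu> i\<bar> \<le> \<delta> * h}"
    have sets: "?A \<in> P.events" "?N \<in> P.events" by simp_all
    have "P.prob ?A \<le> P.prob ((?A - ?N) \<union> ?N)"
      using sets by (intro P.finite_measure_mono sets.Un sets.Diff) auto
    also have "\<dots> \<le> P.prob (?A - ?N) + P.prob ?N"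
      using sets by (intro measure_Un_le sets.Diff)
    finally have "P.prob ?A \<le> P.prob (?A - ?N) + P.prob ?N" .
    then have "P.prob ?A - h \<le> P.prob (?A - ?N)"
      using data_law_deviation_le[OF iD h \<delta>, of lam \<mu>] by linarith
    then have "(\<delta> * h / lam i)\<^sup>2 * (P.prob ?A - h) \<le> (\<delta> * h / lam i)\<^sup>2 * P.prob (?A - ?N)"
      by (rule mult_left_mono) simp
    also have "\<dots> \<le> (\<integral>y. coord_loss lam \<mu> T i y \<partial>data_law D lam \<delta> \<mu>)"
    proof (rule integral_coord_loss_ge[OF T iD])
      show "?A - ?N \<in> sets (data_space D)" using sets by simp
    next
      fix y assume y: "y \<in> ?A - ?N"
      have l: "lam i > 0" using lam[OF iD] .
      have "coord_loss lam \<mu> T i y = ((y i - lam i * \<mu> i) / lam i)\<^sup>2"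
        using y i l by (simp add: coord_loss_def field_simps)
      moreover have "\<bar>\<delta> * h / lam i\<bar> \<le> \<bar>(y i - lam i * \<mu> i) / lam i\<bar>"
      proof -
        have "\<delta> * h \<le> \<bar>y i - lam i * \<mu> i\<bar>" using y by auto
        then show ?thesis using l h \<delta> by (simp add: divide_right_mono)
      qed
      ultimately show "(\<delta> * h / lam i)\<^sup>2 \<le> coord_loss lam \<mu> T i y"
        by (simp only: abs_le_square_iff)
    qed
    finally show ?thesis .
  qed
  then have "(\<Sum>i=1..k. (\<delta> * h / lam i)\<^sup>2 * (P.prob ?A - h))
      \<le> (\<Sum>i=1..k. \<integral>y. coord_loss lam \<mu> T i y \<partial>data_law D lam \<delta> \<mu>)"
    by (intro sum_mono) auto
  also have "\<dots> \<le> (risk D lam \<delta> \<mu> T)\<^sup>2"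
    unfolding risk_sq_eq_sum[OF T] using k
    by (intro sum_mono2) auto
  finally show ?thesis by (simp add: sum_distrib_right)
qed

section \<open>The dimension at a fixed noise level\<close>

text \<open>
  The upper half of the indices contributes at least \<open>k / 2\<close> terms, each at least \<open>(k / 2) powr (2 * p)\<close>.
\<close>

lemma sum_powr_ge:
  fixes p :: real
  assumes "p \<ge> 0" "k \<ge> 1"
  shows "(real k / 2) powr (2 * p + 1) \<le> (\<Sum>i=1..k. real i powr (2 * p))"
proof -
  let ?J = "{(k + 1) div 2..k}"
  have "(real k / 2) powr (2 * p + 1) = real k / 2 * (real k / 2) powr (2 * p)"
    using assms by (simp add: powr_add)
  also have "\<dots> \<le> real (card ?J) * (real k / 2) powr (2 * p)"
    by (intro mult_right_mono) auto
  also have "\<dots> = (\<Sum>i\<in>?J. (real k / 2) powr (2 * p))" by simp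
  also have "\<dots> \<le> (\<Sum>i\<in>?J. real i powr (2 * p))"
    using assms by (intro sum_mono powr_mono2) auto
  also have "\<dots> \<le> (\<Sum>i=1..k. real i powr (2 * p))"
    using assms by (intro sum_mono2) auto
  finally show ?thesis .
qed

text \<open>
  The threshold \<open>h = 1 / 8\<close> in the noise bound leaves a stopping probability of at most
  \<open>1 / 8 + 1 / 8\<close>.
\<close>

lemma prob_late_stopping_le:
  assumes T: "stopping_time (residual_filtration D) T" and k: "1 \<le> k" "k \<le> D" and \<delta>: "\<delta> > 0"
    and p: "p \<ge> 0" and CA: "C\<^sub>A \<ge> 1"
    and lam: "\<And>i. i \<in> {1..D} \<Longrightarrow> 0 < lam i \<and> lam i \<le> C\<^sub>A * real i powr (- p)"
    and risk: "(risk D lam \<delta> \<mu> T)\<^sup>2 \<le> \<delta>\<^sup>2 * (real k / 2) powr (2 * p + 1) / (512 * C\<^sub>A\<^sup>2)"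
  shows "measure (data_law D lam \<delta> \<mu>) {y \<in> space (data_space D). k \<le> T y} \<le> 1 / 4"
proof -
  define S where "S = \<delta>\<^sup>2 * (real k / 2) powr (2 * p + 1) / (64 * C\<^sub>A\<^sup>2)"
  have S: "S > 0" using \<delta> k CA by (simp add: S_def)
  let ?pr = "measure (data_law D lam \<delta> \<mu>) {y \<in> space (data_space D). k \<le> T y}"
  have "S \<le> \<delta>\<^sup>2 / (64 * C\<^sub>A\<^sup>2) * (\<Sum>i=1..k. real i powr (2 * p))"
    using mult_left_mono[OF sum_powr_ge[OF p k(1)], of "\<delta>\<^sup>2 / (64 * C\<^sub>A\<^sup>2)"] by (simp add: S_def)
  also have "\<dots> \<le> (\<Sum>i=1..k. (\<delta> * (1 / 8) / lam i)\<^sup>2)"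
    unfolding sum_distrib_left
  proof (rule sum_mono)
    fix i assume i: "i \<in> {1..k}"
    have l: "0 < lam i" "lam i \<le> C\<^sub>A * real i powr (- p)" using lam[of i] i k by auto
    have "\<delta> * (1 / 8) / (C\<^sub>A * real i powr (- p)) \<le> \<delta> * (1 / 8) / lam i"
      using l \<delta> CA i by (intro divide_left_mono mult_pos_pos) auto
    then have "(\<delta> * (1 / 8) / (C\<^sub>A * real i powr (- p)))\<^sup>2 \<le> (\<delta> * (1 / 8) / lam i)\<^sup>2"
      using \<delta> CA by (intro power_mono) auto
    moreover have "(real i powr (- p))\<^sup>2 * real i powr (2 * p) = 1"
      using i by (simp add: power2_eq_square powr_add[symmetric])
    then have "(\<delta> * (1 / 8) / (C\<^sub>A * real i powr (- p)))\<^sup>2 = \<delta>\<^sup>2 / (64 * C\<^sub>A\<^sup>2) * real i powr (2 * p)"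
      using i CA by (simp add: power_divide power_mult_distrib field_simps)
    ultimately show "\<delta>\<^sup>2 / (64 * C\<^sub>A\<^sup>2) * real i powr (2 * p) \<le> (\<delta> * (1 / 8) / lam i)\<^sup>2" by simp
  qed
  finally have sum: "S \<le> (\<Sum>i=1..k. (\<delta> * (1 / 8) / lam i)\<^sup>2)" .
  have "S * (?pr - 1 / 8) \<le> S * (1 / 8)" if "?pr \<ge> 1 / 8"
  proof -
    have "S * (?pr - 1 / 8) \<le> (\<Sum>i=1..k. (\<delta> * (1 / 8) / lam i)\<^sup>2) * (?pr - 1 / 8)"
      using sum that by (intro mult_right_mono) auto
    also have "\<dots> \<le> (risk D lam \<delta> \<mu> T)\<^sup>2"
      using lam by (intro risk_sq_ge_noise[OF T k(2) _ \<delta>]) auto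
    also have "\<dots> \<le> S * (1 / 8)" using risk by (simp add: S_def)
    finally show ?thesis .
  qed
  then show ?thesis using S by (cases "?pr \<ge> 1 / 8") auto
qed

text \<open>
  The optimal time \<open>t\<close> balances the squared bias \<open>R\<^sup>2 t powr (- 2 \<beta>)\<close> against the variance
  \<open>\<delta>\<^sup>2 t powr (2 p + 1)\<close>.
\<close>

lemma
  assumes "R > 0" "\<delta> > 0" "0 < 2 * \<beta> + 2 * p + 1"
  shows opt_time_pos: "opt_time \<beta> p R \<delta> > 0"
    and opt_rate_eq_opt_time: "opt_rate \<beta> p R \<delta> = R * opt_time \<beta> p R \<delta> powr (- \<beta>)"
    and opt_time_balance: "\<delta>\<^sup>2 * opt_time \<beta> p R \<delta> powr (2 * \<beta> + 2 * p + 1) = R\<^sup>2"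
proof -
  have d: "inverse R * \<delta> > 0" using assms by simp
  show "opt_time \<beta> p R \<delta> > 0" using assms by (simp add: opt_time_def)
  show "opt_rate \<beta> p R \<delta> = R * opt_time \<beta> p R \<delta> powr (- \<beta>)"
    by (simp add: opt_rate_def opt_time_def powr_powr)
  have "opt_time \<beta> p R \<delta> powr (2 * \<beta> + 2 * p + 1) = (inverse R * \<delta>) powr (- 2)"
  proof -
    have "- 2 / s * s = - 2" if "s > 0" for s :: real using that by simp
    from this[OF assms(3)] show ?thesis by (simp only: opt_time_def powr_powr)
  qed
  also have "\<dots> = R\<^sup>2 / \<delta>\<^sup>2"
    using d assms by (simp add: powr_minus powr_numeral power_mult_distrib power_inverse field_simps)
  finally show "\<delta>\<^sup>2 * opt_time \<beta> p R \<delta> powr (2 * \<beta> + 2 * p + 1) = R\<^sup>2"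
    using assms by simp
qed

definition spike :: "nat \<Rightarrow> nat \<Rightarrow> real \<Rightarrow> nat \<Rightarrow> real" where
  "spike D k a = (\<lambda>i\<in>{1..D}. if i = k then a else 0)"

lemma spike_in_sobolev_ellipsoid:
  assumes "1 \<le> k" "k \<le> D" "R > 0"
  shows "spike D k (R * real k powr (- \<beta>)) \<in> sobolev_ellipsoid \<beta> R D"
proof -
  have "(\<Sum>i=1..D. real i powr (2 * \<beta>) * (spike D k (R * real k powr (- \<beta>)) i)\<^sup>2)
      = (\<Sum>i=1..D. if i = k then R\<^sup>2 else 0)"
  proof (rule sum.cong)
    fix i assume "i \<in> {1..D}"
    have "real k powr (2 * \<beta>) * (real k powr (- \<beta>))\<^sup>2 = 1"
      using assms by (simp add: power2_eq_square powr_add[symmetric])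
    then show "real i powr (2 * \<beta>) * (spike D k (R * real k powr (- \<beta>)) i)\<^sup>2 = (if i = k then R\<^sup>2 else 0)"
      using \<open>i \<in> {1..D}\<close> by (simp add: spike_def power_mult_distrib)
  qed simp
  also have "\<dots> = R\<^sup>2" using assms by simp
  finally show ?thesis by (simp add: sobolev_ellipsoid_def spike_def)
qed

lemma zero_in_sobolev_ellipsoid: "(\<lambda>i\<in>{1..D}. 0) \<in> sobolev_ellipsoid \<beta> R D"
  by (simp add: sobolev_ellipsoid_def)

text \<open>
  The rule is confronted with the zero signal and with a spike at \<open>k\<close>, about \<open>t / K\<close>, that is as high as
  the ellipsoid permits. Good risk at zero forces \<open>T < k\<close> with probability at least \<open>3 / 4\<close>. The spike has
  energy at most \<open>M t\<close> in units of \<open>\<delta>\<^sup>2\<close>; if \<open>sqrt D\<close> exceeded \<open>3 M t\<close>, it would be undetected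
  before \<open>k\<close> and the rule would still stop early with probability at least \<open>1 / 4\<close>. The resulting bias
  exceeds the optimal rate by a factor of order \<open>(K / 2) powr \<beta>\<close>, contrary to the choice of \<open>K\<close>.
\<close>

lemma sqrt_dimension_le_opt_time:
  fixes D :: nat and \<beta> p R \<delta> C K C\<^sub>A :: real
  defines "t \<equiv> opt_time \<beta> p R \<delta>"
    and "r \<equiv> opt_rate \<beta> p R \<delta>"
    and "M \<equiv> C\<^sub>A\<^sup>2 * K powr (2 * p + 2 * \<beta>)"
  assumes T: "stopping_time (residual_filtration D) T" and \<delta>: "\<delta> > 0" and R: "R > 0"
    and p: "p \<ge> 0" and \<beta>: "\<beta> > 0" and CA: "C\<^sub>A \<ge> 1"
    and lam: "\<And>i. i \<in> {1..D} \<Longrightarrow> 0 < lam i \<and> lam i \<le> C\<^sub>A * real i powr (- p)"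
    and K: "K \<ge> 2" "(K / 2) powr \<beta> > 2 * C" and C: "C > 0" and t: "t \<ge> K"
    and rough: "\<And>\<mu>. \<mu> \<in> sobolev_ellipsoid \<beta> R D \<Longrightarrow> risk D lam \<delta> \<mu> T \<le> C * r"
    and smooth: "(risk D lam \<delta> (\<lambda>i\<in>{1..D}. 0) T)\<^sup>2 \<le> r\<^sup>2 * ((2 * K) powr (- (2 * p + 1)) / (512 * C\<^sub>A\<^sup>2))"
  shows "sqrt (real D) \<le> 3 * M * t"
proof (rule ccontr)
  assume "\<not> ?thesis"
  then have big: "3 * M * t < sqrt (real D)" by simp
  have t0: "t > 0" and r_eq: "r = R * t powr (- \<beta>)"
    and balance: "\<delta>\<^sup>2 * t powr (2 * \<beta> + 2 * p + 1) = R\<^sup>2"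
    using opt_time_pos opt_rate_eq_opt_time opt_time_balance R \<delta> p \<beta> by (simp_all add: t_def r_def)
  have M1: "M \<ge> 1"
  proof -
    have "1 * 1 \<le> C\<^sub>A\<^sup>2 * K powr (2 * p + 2 * \<beta>)"
      using CA K p \<beta> by (intro mult_mono ge_one_powr_ge_zero) auto
    then show ?thesis by (simp add: M_def)
  qed
  have D9: "9 * M\<^sup>2 * t\<^sup>2 < real D"
  proof -
    have "(3 * M * t)\<^sup>2 < (sqrt (real D))\<^sup>2"
      using big t0 M1 by (intro power_strict_mono) auto
    then show ?thesis by (simp add: power_mult_distrib)
  qed
  define k where "k = nat \<lceil>t / K\<rceil>"
  have tK: "1 \<le> t / K" using t K by simp
  have k_ge: "t / K \<le> real k" unfolding k_def by (rule real_nat_ceiling_ge)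
  have "real k < t / K + 1" unfolding k_def using tK by linarith
  then have k_le: "real k \<le> 2 * t / K" using tK by simp
  have k1: "1 \<le> k" using k_ge tK by linarith
  have kD: "2 * k \<le> D"
  proof -
    have "2 * t / K \<le> t" using K t0 by (simp add: field_simps)
    then have "2 * real k \<le> 2 * t" using k_le by simp
    also have "2 * t \<le> 9 * M\<^sup>2 * t\<^sup>2"
    proof -
      have "1 \<le> M\<^sup>2" using M1 by (simp add: one_le_power)
      then have "2 * t * 1 \<le> (9 * M\<^sup>2 * t) * t"
        using t K t0 by (intro mult_mono) auto
      then show ?thesis by (simp add: power2_eq_square)
    qed
    finally show ?thesis using D9 by linarith
  qed
  have k_lt: "k - 1 < D" using kD k1 by linarith
  let ?z = "\<lambda>i\<in>{1..D}. 0 :: real"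
  define \<nu> where "\<nu> = spike D k (R * real k powr (- \<beta>))"
  interpret P0: prob_space "data_law D lam \<delta> ?z" by (rule prob_space_data_law)
  note [measurable] = pred_stopping_time[OF T]
  let ?A = "{y \<in> space (data_space D). T y < k}"

  \<comment> \<open>at the zero signal, stopping at \<open>k\<close> or later costs too much variance\<close>
  have late: "P0.prob {y \<in> space (data_space D). k \<le> T y} \<le> 1 / 4"
  proof (rule prob_late_stopping_le[OF T k1 _ \<delta> p CA lam])
    have "r\<^sup>2 * (2 * K) powr (- (2 * p + 1)) = \<delta>\<^sup>2 * (t / (2 * K)) powr (2 * p + 1)"
    proof -
      have "r\<^sup>2 = R\<^sup>2 * t powr (- 2 * \<beta>)"
        by (simp add: r_eq power_mult_distrib power2_eq_square powr_add[symmetric])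
      also have "\<dots> = \<delta>\<^sup>2 * t powr (2 * p + 1)"
        by (simp add: balance[symmetric] powr_add[symmetric])
      finally show ?thesis
        using t0 K by (simp only: powr_divide powr_minus_divide) simp
    qed
    also have "\<dots> \<le> \<delta>\<^sup>2 * (real k / 2) powr (2 * p + 1)"
      using k_ge t0 K p by (intro mult_left_mono powr_mono2) (auto simp: field_simps)
    finally show "(risk D lam \<delta> ?z T)\<^sup>2 \<le> \<delta>\<^sup>2 * (real k / 2) powr (2 * p + 1) / (512 * C\<^sub>A\<^sup>2)"
      using smooth CA by (simp add: divide_simps split: if_splits)
  qed (use kD in auto)
  have "?A = space (data_law D lam \<delta> ?z) - {y \<in> space (data_space D). k \<le> T y}" by auto
  then have early0: "P0.prob ?A \<ge> 3 / 4"
    using late by (subst \<open>?A = _\<close>, subst P0.prob_compl) auto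

  \<comment> \<open>the energy of the spike, in units of \<open>\<delta>\<^sup>2\<close>\<close>
  define a where "a = (\<Sum>i\<in>{k - 1<..D}. (lam i * \<nu> i / \<delta>)\<^sup>2)"
  have "a = (\<Sum>i\<in>{k - 1<..D}. if i = k then (lam k * \<nu> k / \<delta>)\<^sup>2 else 0)"
    unfolding a_def by (intro sum.cong) (auto simp: \<nu>_def spike_def)
  also have "\<dots> = (lam k * (R * real k powr (- \<beta>)) / \<delta>)\<^sup>2"
    using k1 kD by (simp add: \<nu>_def spike_def)
  also have "\<dots> \<le> (C\<^sub>A * real k powr (- p) * (R * real k powr (- \<beta>)) / \<delta>)\<^sup>2"
    using lam[of k] k1 kD R \<delta>
    by (intro power_mono divide_right_mono mult_right_mono) (auto intro!: mult_nonneg_nonneg less_imp_le)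
  also have "\<dots> = C\<^sub>A\<^sup>2 * real k powr (- (2 * p + 2 * \<beta>)) * (R\<^sup>2 / \<delta>\<^sup>2)"
    by (simp add: power_mult_distrib power_divide power2_eq_square powr_add[symmetric])
  also have "\<dots> \<le> C\<^sub>A\<^sup>2 * (t / K) powr (- (2 * p + 2 * \<beta>)) * (R\<^sup>2 / \<delta>\<^sup>2)"
    using k_ge t0 K p \<beta> by (intro mult_right_mono mult_left_mono powr_mono2') auto
  also have "R\<^sup>2 / \<delta>\<^sup>2 = t powr (2 * \<beta> + 2 * p + 1)"
    using balance \<delta> by (simp add: field_simps)
  also have "C\<^sub>A\<^sup>2 * (t / K) powr (- (2 * p + 2 * \<beta>)) * t powr (2 * \<beta> + 2 * p + 1) = M * t"
  proof -
    have "(t / K) powr (- e) * t powr (e + 1) = K powr e * t" for e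
      using t0 K by (simp only: powr_minus_divide powr_add) (simp add: powr_divide)
    from this[of "2 * p + 2 * \<beta>"] show ?thesis
      by (simp add: M_def add.commute[of "2 * \<beta>"] mult.assoc)
  qed
  finally have a_le: "a \<le> M * t" .
  have a0: "a \<ge> 0" by (simp add: a_def sum_nonneg)
  have "a\<^sup>2 / (2 * real (D - (k - 1))) \<le> 1 / 9"
  proof -
    have "9 * a\<^sup>2 \<le> 9 * (M * t)\<^sup>2" using a_le a0 by (intro mult_left_mono power_mono) auto
    also have "\<dots> \<le> real D" using D9 by (simp add: power_mult_distrib)
    also have "\<dots> \<le> 2 * real (D - (k - 1))" using kD k1 by linarith
    finally show ?thesis using k_lt by (simp add: field_simps)
  qed
  then have "exp (a\<^sup>2 / (2 * real (D - (k - 1)))) \<le> exp (1 / 9)" by simp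
  also have "\<dots> \<le> 9 / (8::real)"
  proof -
    have "8 / 9 \<le> exp (- (1 / 9) :: real)" using exp_ge_add_one_self[of "- (1 / 9) :: real"] by simp
    then show ?thesis by (simp add: exp_minus field_simps)
  qed
  finally have "sqrt (exp (a\<^sup>2 / (2 * real (D - (k - 1)))) - 1) \<le> sqrt ((1 / 2)\<^sup>2)"
    by (intro real_sqrt_le_mono) (simp add: power2_eq_square)
  then have e: "sqrt (exp (a\<^sup>2 / (2 * real (D - (k - 1)))) - 1) \<le> 1 / 2" by simp
  have A: "?A \<in> sets (residual_filtration D (k - 1))"
  proof -
    have "?A = {y \<in> space (residual_filtration D (k - 1)). T y \<le> k - 1}"
      using k1 filtration.space_F[OF filtration_residual] by auto
    then show ?thesis using stopping_timeD[OF T, of "k - 1"] by (simp add: Measurable.pred_def)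
  qed
  have "P0.prob ?A \<le> measure (data_law D lam \<delta> \<nu>) ?A + sqrt (exp (a\<^sup>2 / (2 * real (D - (k - 1)))) - 1)"
    unfolding a_def
    by (rule data_law_residual_indistinguishable[OF k_lt \<delta> A]) (auto simp: \<nu>_def spike_def)
  then have early: "measure (data_law D lam \<delta> \<nu>) ?A \<ge> 1 / 4" using e early0 by linarith

  \<comment> \<open>the bias of stopping before the spike is too large\<close>
  have "(K / 2) powr (2 * \<beta>) * r\<^sup>2 / 4 = R\<^sup>2 * (2 * t / K) powr (- 2 * \<beta>) / 4"
  proof -
    have "(2 * t / K) powr (- 2 * \<beta>) = (K / 2) powr (2 * \<beta>) * t powr (- 2 * \<beta>)"
      using t0 K by (simp add: powr_divide powr_mult powr_minus field_simps)
    moreover have "r\<^sup>2 = R\<^sup>2 * t powr (- 2 * \<beta>)"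
      by (simp add: r_eq power_mult_distrib power2_eq_square powr_add[symmetric])
    ultimately show ?thesis by simp
  qed
  also have "\<dots> \<le> R\<^sup>2 * real k powr (- 2 * \<beta>) / 4"
    using k_le k1 \<beta> by (intro divide_right_mono mult_left_mono powr_mono2') auto
  also have "\<dots> = (\<nu> k)\<^sup>2 * (1 / 4)"
    using k1 kD by (simp add: \<nu>_def spike_def power_mult_distrib power2_eq_square powr_add[symmetric])
  also have "\<dots> \<le> (\<nu> k)\<^sup>2 * measure (data_law D lam \<delta> \<nu>) ?A"
    using early by (intro mult_left_mono) auto
  also have "\<dots> \<le> (risk D lam \<delta> \<nu> T)\<^sup>2"
    using k1 kD by (intro risk_sq_ge_bias[OF T]) auto
  also have "\<dots> \<le> (C * r)\<^sup>2"
  proof (rule power_mono)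
    show "risk D lam \<delta> \<nu> T \<le> C * r"
      unfolding \<nu>_def using k1 kD R by (intro rough spike_in_sobolev_ellipsoid) auto
  qed (simp add: risk_def)
  finally have "((K / 2) powr (2 * \<beta>) / 4) * r\<^sup>2 \<le> C\<^sup>2 * r\<^sup>2" by (simp add: power_mult_distrib)
  moreover have "r > 0" using r_eq R t0 by simp
  ultimately have "(K / 2) powr (2 * \<beta>) \<le> (2 * C)\<^sup>2" by (simp add: power_mult_distrib)
  moreover have "(K / 2) powr (2 * \<beta>) = ((K / 2) powr \<beta>)\<^sup>2"
    by (simp add: power2_eq_square powr_add[symmetric])
  moreover have "(2 * C)\<^sup>2 < ((K / 2) powr \<beta>)\<^sup>2"
    using K C by (intro power_strict_mono) auto
  ultimately show False by simp
qed

section \<open>Vanishing noise\<close>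

lemma opt_time_at_top:
  assumes "R > 0" "0 < 2 * \<beta> + 2 * p + 1"
  shows "filterlim (opt_time \<beta> p R) at_top (at_right 0)"
proof -
  define a where "a = 2 / (2 * \<beta> + 2 * p + 1)"
  have a: "a > 0" using assms by (simp add: a_def)
  have "filterlim (\<lambda>\<delta>. (inverse R * \<delta>) powr (- a)) at_top (at_right 0)"
    using a assms(1) by real_asymp
  then show ?thesis by (simp add: opt_time_def[abs_def] a_def)
qed

text \<open>
  The exponent \<open>2 \<beta> / (2 \<beta> + 2 p + 1)\<close> is strictly increasing in \<open>\<beta>\<close>.
\<close>

lemma opt_rate_smallo:
  assumes "R > 0" "R' > 0" "p \<ge> 0" "\<beta> \<ge> 0" "\<beta> < \<beta>'"
  shows "opt_rate \<beta>' p R' \<in> o[at_right 0](opt_rate \<beta> p R)"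
proof -
  define e e' where "e = 2 * \<beta> / (2 * \<beta> + 2 * p + 1)" and "e' = 2 * \<beta>' / (2 * \<beta>' + 2 * p + 1)"
  have "2 * \<beta> * (2 * p + 1) < 2 * \<beta>' * (2 * p + 1)" using assms by simp
  then have "e < e'" using assms by (simp add: e_def e'_def field_simps)
  then have "(\<lambda>\<delta>. R' * (inverse R' * \<delta>) powr e') \<in> o[at_right 0](\<lambda>\<delta>. R * (inverse R * \<delta>) powr e)"
    using assms(1,2) by real_asymp
  then show ?thesis by (simp add: opt_rate_def[abs_def] e_def e'_def)
qed

lemma sqrt_dimension_bigo_opt_time:
  fixes D :: "real \<Rightarrow> nat" and lam :: "real \<Rightarrow> nat \<Rightarrow> real"
  assumes p: "p \<ge> 0" and CA: "C\<^sub>A \<ge> 1"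
    and lam: "\<And>\<delta> i. \<delta> > 0 \<Longrightarrow> i \<in> {1..D \<delta>} \<Longrightarrow> 0 < lam \<delta> i \<and> lam \<delta> i \<le> C\<^sub>A * real i powr (- p)"
    and \<beta>: "0 < \<beta>" "\<beta> < \<beta>'" and R: "R > 0" "R' > 0"
    and \<tau>: "G_stopping_rule D \<tau>"
    and rough: "rate_optimal D lam p \<tau> \<beta> R" and smooth: "rate_optimal D lam p \<tau> \<beta>' R'"
  shows "(\<lambda>\<delta>. sqrt (real (D \<delta>))) \<in> O[at_right 0](opt_time \<beta> p R)"
proof -
  obtain C where C: "C > 0" and r: "\<forall>\<^sub>F \<delta> in at_right 0. \<forall>\<mu>\<in>sobolev_ellipsoid \<beta> R (D \<delta>).
        risk (D \<delta>) (lam \<delta>) \<delta> \<mu> (\<tau> \<delta>) \<le> C * opt_rate \<beta> p R \<delta>"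
    using rough by (auto simp: rate_optimal_def)
  obtain C' where C': "C' > 0" and r': "\<forall>\<^sub>F \<delta> in at_right 0. \<forall>\<mu>\<in>sobolev_ellipsoid \<beta>' R' (D \<delta>).
        risk (D \<delta>) (lam \<delta>) \<delta> \<mu> (\<tau> \<delta>) \<le> C' * opt_rate \<beta>' p R' \<delta>"
    using smooth by (auto simp: rate_optimal_def)
  \<comment> \<open>large enough for \<open>(K / 2) powr \<beta> > 2 * C\<close>\<close>
  define K where "K = 2 * max 1 ((2 * C + 1) powr (1 / \<beta>))"
  have K: "K \<ge> 2" by (simp add: K_def)
  have "2 * C < ((2 * C + 1) powr (1 / \<beta>)) powr \<beta>"
    using C \<beta> by (simp add: powr_powr)
  also have "\<dots> \<le> (K / 2) powr \<beta>"
    using \<beta> by (intro powr_mono2) (auto simp: K_def)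
  finally have KC: "(K / 2) powr \<beta> > 2 * C" .
  define \<kappa> where "\<kappa> = (2 * K) powr (- (2 * p + 1)) / (512 * C\<^sub>A\<^sup>2)"
  have \<kappa>: "\<kappa> > 0" using K CA by (simp add: \<kappa>_def)
  have pos: "\<forall>\<^sub>F \<delta> in at_right 0. \<delta> > (0::real)"
    by (simp add: eventually_at_right_less)
  have "\<forall>\<^sub>F \<delta> in at_right 0. K \<le> opt_time \<beta> p R \<delta>"
    using opt_time_at_top[of R \<beta> p] R p \<beta> by (simp add: filterlim_at_top)
  moreover have "\<forall>\<^sub>F \<delta> in at_right 0. norm (opt_rate \<beta>' p R' \<delta>) \<le> sqrt \<kappa> / C' * norm (opt_rate \<beta> p R \<delta>)"
    using opt_rate_smallo[of R R' p \<beta> \<beta>'] R p \<beta> \<kappa> C' by (intro landau_o.smallD) auto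
  ultimately have "\<forall>\<^sub>F \<delta> in at_right 0. sqrt (real (D \<delta>))
      \<le> 3 * (C\<^sub>A\<^sup>2 * K powr (2 * p + 2 * \<beta>)) * opt_time \<beta> p R \<delta>"
    using pos r r'
  proof eventually_elim
    case (elim \<delta>)
    have T: "stopping_time (residual_filtration (D \<delta>)) (\<tau> \<delta>)"
      using \<tau> elim by (simp add: G_stopping_rule_def)
    have "risk (D \<delta>) (lam \<delta>) \<delta> (\<lambda>i\<in>{1..D \<delta>}. 0) (\<tau> \<delta>) \<le> C' * opt_rate \<beta>' p R' \<delta>"
      using elim zero_in_sobolev_ellipsoid by blast
    also have "\<dots> \<le> C' * (sqrt \<kappa> / C' * opt_rate \<beta> p R \<delta>)"
      using elim C' R by (intro mult_left_mono) (auto simp: opt_rate_def)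
    finally have "risk (D \<delta>) (lam \<delta>) \<delta> (\<lambda>i\<in>{1..D \<delta>}. 0) (\<tau> \<delta>) \<le> sqrt \<kappa> * opt_rate \<beta> p R \<delta>"
      using C' by simp
    then have "(risk (D \<delta>) (lam \<delta>) \<delta> (\<lambda>i\<in>{1..D \<delta>}. 0) (\<tau> \<delta>))\<^sup>2 \<le> (sqrt \<kappa> * opt_rate \<beta> p R \<delta>)\<^sup>2"
      by (intro power_mono) (auto simp: risk_def)
    also have "\<dots> = (opt_rate \<beta> p R \<delta>)\<^sup>2 * \<kappa>"
      using \<kappa> by (simp add: power_mult_distrib)
    finally have null: "(risk (D \<delta>) (lam \<delta>) \<delta> (\<lambda>i\<in>{1..D \<delta>}. 0) (\<tau> \<delta>))\<^sup>2
        \<le> (opt_rate \<beta> p R \<delta>)\<^sup>2 * ((2 * K) powr (- (2 * p + 1)) / (512 * C\<^sub>A\<^sup>2))"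
      unfolding \<kappa>_def .
    show ?case
      by (rule sqrt_dimension_le_opt_time[OF T elim(3) R(1) p \<beta>(1) CA lam[OF elim(3)] K KC C elim(1) _ null])
         (use elim(4) in auto)
  qed
  then show ?thesis
    using pos
    by (intro bigoI[where c = "3 * (C\<^sub>A\<^sup>2 * K powr (2 * p + 2 * \<beta>))"])
       (auto elim!: eventually_elim2 simp: opt_time_def)
qed

text \<open>
  Taking logarithms in \<open>D \<le> (c * opt_time \<beta> p R \<delta>)\<^sup>2\<close> gives
  \<open>ln D \<le> c1 + 2 / s * ln (\<delta> powr (- 2))\<close> with \<open>s = 2 * \<beta> + 2 * p + 1\<close>, and \<open>ln D\<close> tends to infinity.
\<close>

lemma Liminf_ge_of_sqrt_dimension_bigo:
  fixes D :: "real \<Rightarrow> nat"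
  assumes D: "filterlim D at_top (at_right 0)" and R: "R > 0" and s: "0 < 2 * \<beta> + 2 * p + 1"
    and O: "(\<lambda>\<delta>. sqrt (real (D \<delta>))) \<in> O[at_right 0](opt_time \<beta> p R)"
  shows "ereal (\<beta> + p + 1 / 2) \<le> Liminf (at_right 0) (\<lambda>\<delta>. ereal (ln (\<delta> powr (- 2)) / ln (real (D \<delta>))))"
proof -
  define s where "s = 2 * \<beta> + 2 * p + 1"
  have s0: "s > 0" using s by (simp add: s_def)
  obtain c where c: "c > 0"
    and bound: "\<forall>\<^sub>F \<delta> in at_right 0. norm (sqrt (real (D \<delta>))) \<le> c * norm (opt_time \<beta> p R \<delta>)"
    using landau_o.bigE[OF O] by blast
  define c1 where "c1 = 2 * ln c + 4 / s * ln R"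
  have pos: "\<forall>\<^sub>F \<delta> in at_right 0. \<delta> > (0::real)"
    by (simp add: eventually_at_right_less)
  have lnD: "filterlim (\<lambda>\<delta>. ln (real (D \<delta>))) at_top (at_right 0)"
    by (rule filterlim_compose[OF ln_at_top filterlim_compose[OF filterlim_real_sequentially D]])
  have "((\<lambda>\<delta>. s / 2 * (1 - c1 / ln (real (D \<delta>)))) \<longlongrightarrow> s / 2 * (1 - 0)) (at_right 0)"
    by (intro tendsto_intros tendsto_divide_0[OF tendsto_const] filterlim_at_top_imp_at_infinity[OF lnD])
  then have lim: "Liminf (at_right 0) (\<lambda>\<delta>. ereal (s / 2 * (1 - c1 / ln (real (D \<delta>))))) = ereal (s / 2)"
    by (intro lim_imp_Liminf) auto
  have "\<forall>\<^sub>F \<delta> in at_right 0. ereal (s / 2 * (1 - c1 / ln (real (D \<delta>))))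
      \<le> ereal (ln (\<delta> powr (- 2)) / ln (real (D \<delta>)))"
    using bound pos filterlim_at_top_dense[THEN iffD1, OF lnD, rule_format, of 0]
  proof eventually_elim
    case (elim \<delta>)
    let ?t = "opt_time \<beta> p R \<delta>"
    have D1: "real (D \<delta>) > 0" using elim(3) by (cases "D \<delta> = 0") auto
    have t: "?t > 0" using elim R s by (intro opt_time_pos) auto
    have "real (D \<delta>) = (sqrt (real (D \<delta>)))\<^sup>2" by simp
    also have "\<dots> \<le> (c * ?t)\<^sup>2" using elim t by (intro power_mono) auto
    finally have "ln (real (D \<delta>)) \<le> ln ((c * ?t)\<^sup>2)"
      using D1 c t by (subst ln_le_cancel_iff) auto
    also have "\<dots> = 2 * ln c + 2 * ln ?t"
      using c t by (simp add: ln_realpow ln_mult)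
    also have "ln ?t = - 2 / s * (ln \<delta> - ln R)"
      using elim R by (simp add: opt_time_def s_def ln_powr ln_mult ln_inverse)
    also have "2 * ln c + 2 * (- 2 / s * (ln \<delta> - ln R)) = c1 + 2 / s * ln (\<delta> powr (- 2))"
      using elim by (simp add: c1_def ln_powr algebra_simps diff_divide_distrib)
    finally have "s / 2 * (ln (real (D \<delta>)) - c1) \<le> ln (\<delta> powr (- 2))"
      using s0 by (simp add: field_simps)
    then have "s / 2 * (ln (real (D \<delta>)) - c1) / ln (real (D \<delta>)) \<le> ln (\<delta> powr (- 2)) / ln (real (D \<delta>))"
      using elim(3) by (intro divide_right_mono) auto
    then show ?case using elim(3) by (simp add: field_simps)
  qed
  from Liminf_mono[OF this]
  have "Liminf (at_right 0) (\<lambda>\<delta>. ereal (s / 2 * (1 - c1 / ln (real (D \<delta>)))))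
      \<le> Liminf (at_right 0) (\<lambda>\<delta>. ereal (ln (\<delta> powr (- 2)) / ln (real (D \<delta>))))" .
  moreover have "s / 2 = \<beta> + p + 1 / 2" by (simp add: s_def)
  ultimately show ?thesis unfolding lim by simp
qed

lemma ereal_le_of_dense_shift:
  fixes l :: ereal
  assumes "a < b" and le: "\<And>x. a < x \<Longrightarrow> x < b \<Longrightarrow> ereal (x + q) \<le> l"
  shows "ereal (b + q) \<le> l"
proof (cases l)
  case (real r)
  have "b \<le> r - q"
  proof (rule dense_le_bounded[OF assms(1)])
    fix x assume "a < x" "x < b"
    from le[OF this] show "x \<le> r - q" unfolding real by simp
  qed
  then show ?thesis unfolding real by simp
next
  case MInf
  obtain x where "a < x" "x < b" using dense[OF assms(1)] by blast
  from le[OF this] show ?thesis unfolding MInf by simp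
qed simp

theorem corollary2p6:
  fixes p C\<^sub>A :: real
    and D :: "real \<Rightarrow> nat"
    and lam :: "real \<Rightarrow> nat \<Rightarrow> real"
  assumes "p \<ge> 0" and "C\<^sub>A \<ge> 1"
    and "\<And>\<delta>. \<delta> > 0 \<Longrightarrow> D \<delta> \<ge> 1"
    and "filterlim D at_top (at_right 0)"
    and "\<And>\<delta> i j. \<delta> > 0 \<Longrightarrow> 1 \<le> i \<Longrightarrow> i \<le> j \<Longrightarrow> j \<le> D \<delta> \<Longrightarrow> lam \<delta> j \<le> lam \<delta> i"
    and "\<And>\<delta> i. \<delta> > 0 \<Longrightarrow> 1 \<le> i \<Longrightarrow> i \<le> D \<delta> \<Longrightarrow> lam \<delta> i > 0"
    and "\<And>\<delta> i. \<delta> > 0 \<Longrightarrow> 1 \<le> i \<Longrightarrow> i \<le> D \<delta> \<Longrightarrow>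
           inverse C\<^sub>A * real i powr (- p) \<le> lam \<delta> i \<and> lam \<delta> i \<le> C\<^sub>A * real i powr (- p)"
  shows "(\<forall>\<beta>\<^sub>m \<beta>\<^sub>p R\<^sub>m R\<^sub>p :: real. 0 < \<beta>\<^sub>m \<and> \<beta>\<^sub>m < \<beta>\<^sub>p \<and> 0 < R\<^sub>m \<and> 0 < R\<^sub>p \<longrightarrow>
            (\<exists>\<tau>. G_stopping_rule D \<tau> \<and>
               (\<exists>C>0. \<forall>\<^sub>F \<delta> in at_right 0. \<forall>(\<beta>, R) \<in> {(\<beta>\<^sub>m, R\<^sub>m), (\<beta>\<^sub>p, R\<^sub>p)}.
                  \<forall>\<mu>\<in>sobolev_ellipsoid \<beta> R (D \<delta>).
                    risk (D \<delta>) (lam \<delta>) \<delta> \<mu> (\<tau> \<delta>) \<le> C * opt_rate \<beta> p R \<delta>)) \<longrightarrow>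
            (\<lambda>\<delta>. sqrt (real (D \<delta>))) \<in> O[at_right 0](\<lambda>\<delta>. opt_time \<beta>\<^sub>m p R\<^sub>m \<delta>)) \<and>
         (\<forall>\<tau> \<beta>_min \<beta>_max R. 0 \<le> \<beta>_min \<and> \<beta>_min < \<beta>_max \<and> 0 < R \<and> G_stopping_rule D \<tau> \<and>
            (\<forall>\<beta>\<in>{\<beta>_min..\<beta>_max}. rate_optimal D lam p \<tau> \<beta> R) \<longrightarrow>
            ereal \<beta>_max \<le>
              Liminf (at_right 0) (\<lambda>\<delta>. ereal (ln (\<delta> powr (- 2)) / ln (real (D \<delta>))))
                - ereal p - ereal (1 / 2))"
proof (intro conjI allI impI; elim conjE exE)
  have lam: "0 < lam \<delta> i \<and> lam \<delta> i \<le> C\<^sub>A * real i powr (- p)" if "\<delta> > 0" "i \<in> {1..D \<delta>}" for \<delta> i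
    using assms(6,7)[of \<delta> i] that by auto
  have bigo: "(\<lambda>\<delta>. sqrt (real (D \<delta>))) \<in> O[at_right 0](opt_time \<beta> p R)"
    if "0 < \<beta>" "\<beta> < \<beta>'" "0 < R" "0 < R'" "G_stopping_rule D \<tau>"
      "rate_optimal D lam p \<tau> \<beta> R" "rate_optimal D lam p \<tau> \<beta>' R'" for \<beta> \<beta>' R R' \<tau>
    by (rule sqrt_dimension_bigo_opt_time[OF assms(1,2) lam that])
  {
    fix \<beta>\<^sub>m \<beta>\<^sub>p R\<^sub>m R\<^sub>p :: real and \<tau> C
    assume \<beta>: "0 < \<beta>\<^sub>m" "\<beta>\<^sub>m < \<beta>\<^sub>p" and R: "0 < R\<^sub>m" "0 < R\<^sub>p" and \<tau>: "G_stopping_rule D \<tau>" and C: "C > 0"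
      and bound: "\<forall>\<^sub>F \<delta> in at_right 0. \<forall>(\<beta>, R) \<in> {(\<beta>\<^sub>m, R\<^sub>m), (\<beta>\<^sub>p, R\<^sub>p)}.
                  \<forall>\<mu>\<in>sobolev_ellipsoid \<beta> R (D \<delta>).
                    risk (D \<delta>) (lam \<delta>) \<delta> \<mu> (\<tau> \<delta>) \<le> C * opt_rate \<beta> p R \<delta>"
    have "rate_optimal D lam p \<tau> \<beta>\<^sub>m R\<^sub>m" "rate_optimal D lam p \<tau> \<beta>\<^sub>p R\<^sub>p"
      unfolding rate_optimal_def using C bound by (auto elim!: eventually_mono)
    then show "(\<lambda>\<delta>. sqrt (real (D \<delta>))) \<in> O[at_right 0](\<lambda>\<delta>. opt_time \<beta>\<^sub>m p R\<^sub>m \<delta>)"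
      using bigo \<beta> R \<tau> by blast
  next
    fix \<tau> and \<beta>_min \<beta>_max R :: real
    assume \<beta>: "0 \<le> \<beta>_min" "\<beta>_min < \<beta>_max" and R: "0 < R" and \<tau>: "G_stopping_rule D \<tau>"
      and opt: "\<forall>\<beta>\<in>{\<beta>_min..\<beta>_max}. rate_optimal D lam p \<tau> \<beta> R"
    let ?l = "Liminf (at_right 0) (\<lambda>\<delta>. ereal (ln (\<delta> powr (- 2)) / ln (real (D \<delta>))))"
    \<comment> \<open>each \<open>\<beta>\<close> strictly inside the interval plays the rough class against the smooth class \<open>\<beta>_max\<close>\<close>
    have ge: "ereal (\<beta> + p + 1 / 2) \<le> ?l" if "\<beta>_min < \<beta>" "\<beta> < \<beta>_max" for \<beta>
    proof (rule Liminf_ge_of_sqrt_dimension_bigo[OF assms(4) R])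
      show "(\<lambda>\<delta>. sqrt (real (D \<delta>))) \<in> O[at_right 0](opt_time \<beta> p R)"
        using that \<beta> opt by (intro bigo[OF _ that(2) R R \<tau>]) auto
      show "0 < 2 * \<beta> + 2 * p + 1" using that \<beta> assms(1) by linarith
    qed
    show "ereal \<beta>_max \<le> ?l - ereal p - ereal (1 / 2)"
    proof -
      have le: "ereal (\<beta>_max + (p + 1 / 2)) \<le> ?l"
        by (rule ereal_le_of_dense_shift[OF \<beta>(2)]) (use ge in \<open>simp add: add.assoc\<close>)
      have "ereal (\<beta>_max + (p + 1 / 2)) \<le> l \<Longrightarrow> ereal \<beta>_max \<le> l - ereal p - ereal (1 / 2)" for l
        by (cases l) auto
      from this[OF le] show ?thesis .
    qed
  }
qed

end
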